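(* The Freyd completion $\mathbf{D}(\mathbf{Rel})$ of the quantaloid $\mathbf{Rel}$ of sets and relations is equivalent (as a quantaloid) to $\mathbf{IntRel}_{\mathsf o}$.
   Context: A quantaloid is a category whose hom-sets are complete lattices and whose composition preserves arbitrary joins in each variable. A homomorphism of quantaloids is a functor preserving joins of arrows; it is an equivalence of quantaloids if the underlying functor is an equivalence of categories. A congruence on a quantaloid is a family of equivalence relations on the hom-sets compatible with composition and arbitrary joins; it induces a quotient quantaloid with the same objects and with equivalence classes as arrows. $\mathbf{Rel}$ is the quantaloid of sets and binary relations $\phi:X\nrightarrow Y$ (subsets of $X\times Y$), ordered by inclusion, with the usual composition: $x(\psi\circ\phi)z$ iff there is $y$ with $x\phi y$ and $y\psi z$. $\mathbf{Arr}(\mathbf{Rel})$ has relations as objects; arrows from $\phi:X\nrightarrow Y$ to $\psi:X'\nrightarrow Y'$ are pairs of relations $(\zeta:X\nrightarrow X',\eta:Y\nrightarrow Y')$ with $\psi\circ\zeta=\eta\circ\phi$, composed and ordered componentwise. Put $(\zeta,\eta)\sim(\zeta',\eta')$ iff $\psi\circ\zeta=\psi\circ\zeta'$ (equivalently $\eta\circ\phi=\eta'\circ\phi$). The Freyd completion is the quotient quantaloid $\mathbf{D}(\mathbf{Rel}):=\mathbf{Arr}(\mathbf{Rel})/\!\sim$. An interior space $(X,a)$ is a set $X$ with an interior operator $a$ on its powerset $\mathbf{2}^X$, i.e. a monotone map $a:\mathbf{2}^X\to\mathbf{2}^X$ with $a(A)\subseteq A$ and $a(a(A))=a(A)$ for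 all $A$ (preservation of finite intersections is not required). For a relation $\zeta:X\nrightarrow Y$ and $B\subseteq Y$ let $\zeta^*B=\{x\in X\mid\exists y\in B:\ x\zeta y\}$. A continuous relation $\zeta:(X,a)\nrightarrow(Y,b)$ is a relation $\zeta:X\nrightarrow Y$ with $\zeta^*b(B)\subseteq a(\zeta^*B)$ for all $B\subseteq Y$. $\mathbf{IntRel}$ is the quantaloid of interior spaces and continuous relations (order and composition as in $\mathbf{Rel}$). For continuous $\zeta,\zeta':(X,a)\nrightarrow(Y,b)$ put $\zeta\sim\zeta'$ iff $\zeta^*b(B)=\zeta'^*b(B)$ for all $B\subseteq Y$; this is a congruence and $\mathbf{IntRel}_{\mathsf o}:=\mathbf{IntRel}/\!\sim$. *)

theory Defs
  imports "HOL-Algebra.Complete_Lattice" "HOL-Library.FuncSet" "HOL-Library.Equipollence"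
begin

section \<open>Categories, functors and natural isomorphisms\<close>

text \<open>
  An arrow does not carry its domain and codomain: hom-sets need not be disjoint, and composition
  is indexed by the three objects involved. For \<open>f : X \<rightarrow> Y\<close> and \<open>g : Y \<rightarrow> Z\<close> the composite
  \<open>g \<circ> f\<close> is \<open>Comp C X Y Z g f\<close>. Only the values at objects and arrows of \<open>C\<close> matter.
\<close>

record ('o, 'a) cat =
  Obj :: "'o set"
  Hom :: "'o \<Rightarrow> 'o \<Rightarrow> 'a set"
  Ident :: "'o \<Rightarrow> 'a"
  Comp :: "'o \<Rightarrow> 'o \<Rightarrow> 'o \<Rightarrow> 'a \<Rightarrow> 'a \<Rightarrow> 'a"

locale category =
  fixes C :: "('o, 'a, 'm) cat_scheme"
  assumes ident_in_hom: "X \<in> Obj C \<Longrightarrow> Ident C X \<in> Hom C X X"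
    and comp_in_hom:
      "\<lbrakk>X \<in> Obj C; Y \<in> Obj C; Z \<in> Obj C; f \<in> Hom C X Y; g \<in> Hom C Y Z\<rbrakk>
        \<Longrightarrow> Comp C X Y Z g f \<in> Hom C X Z"
    and comp_ident_right:
      "\<lbrakk>X \<in> Obj C; Y \<in> Obj C; f \<in> Hom C X Y\<rbrakk> \<Longrightarrow> Comp C X X Y f (Ident C X) = f"
    and comp_ident_left:
      "\<lbrakk>X \<in> Obj C; Y \<in> Obj C; f \<in> Hom C X Y\<rbrakk> \<Longrightarrow> Comp C X Y Y (Ident C Y) f = f"
    and comp_assoc:
      "\<lbrakk>W \<in> Obj C; X \<in> Obj C; Y \<in> Obj C; Z \<in> Obj C;
        f \<in> Hom C W X; g \<in> Hom C X Y; h \<in> Hom C Y Z\<rbrakk>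
        \<Longrightarrow> Comp C W Y Z h (Comp C W X Y g f) = Comp C W X Z (Comp C X Y Z h g) f"

definition iso_arrow :: "('o, 'a, 'm) cat_scheme \<Rightarrow> 'o \<Rightarrow> 'o \<Rightarrow> 'a \<Rightarrow> bool" where
  "iso_arrow C X Y f \<longleftrightarrow> f \<in> Hom C X Y \<and>
    (\<exists>g \<in> Hom C Y X. Comp C X Y X g f = Ident C X \<and> Comp C Y X Y f g = Ident C Y)"

record ('o, 'a, 'p, 'b) functor_map =
  on_obj :: "'o \<Rightarrow> 'p"
  on_arr :: "'o \<Rightarrow> 'o \<Rightarrow> 'a \<Rightarrow> 'b"

locale category_functor = source: category C + target: category D
  for C :: "('o, 'a, 'm) cat_scheme" and D :: "('p, 'b, 'n) cat_scheme" +
  fixes F :: "('o, 'a, 'p, 'b) functor_map"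
  assumes on_obj_closed: "X \<in> Obj C \<Longrightarrow> on_obj F X \<in> Obj D"
    and on_arr_closed:
      "\<lbrakk>X \<in> Obj C; Y \<in> Obj C; f \<in> Hom C X Y\<rbrakk>
        \<Longrightarrow> on_arr F X Y f \<in> Hom D (on_obj F X) (on_obj F Y)"
    and preserves_ident:
      "X \<in> Obj C \<Longrightarrow> on_arr F X X (Ident C X) = Ident D (on_obj F X)"
    and preserves_comp:
      "\<lbrakk>X \<in> Obj C; Y \<in> Obj C; Z \<in> Obj C; f \<in> Hom C X Y; g \<in> Hom C Y Z\<rbrakk>
        \<Longrightarrow> on_arr F X Z (Comp C X Y Z g f) =
          Comp D (on_obj F X) (on_obj F Y) (on_obj F Z) (on_arr F Y Z g) (on_arr F X Y f)"

definition identity_functor :: "('o, 'a, 'o, 'a) functor_map" where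
  "identity_functor = \<lparr>on_obj = (\<lambda>X. X), on_arr = (\<lambda>X Y f. f)\<rparr>"

definition compose_functors ::
  "('p, 'b, 'q, 'c) functor_map \<Rightarrow> ('o, 'a, 'p, 'b) functor_map \<Rightarrow> ('o, 'a, 'q, 'c) functor_map"
  where
  "compose_functors G F =
    \<lparr>on_obj = (\<lambda>X. on_obj G (on_obj F X)),
     on_arr = (\<lambda>X Y f. on_arr G (on_obj F X) (on_obj F Y) (on_arr F X Y f))\<rparr>"

definition naturally_isomorphic ::
  "('o, 'a, 'm) cat_scheme \<Rightarrow> ('p, 'b, 'n) cat_scheme \<Rightarrow>
    ('o, 'a, 'p, 'b) functor_map \<Rightarrow> ('o, 'a, 'p, 'b) functor_map \<Rightarrow> bool" where
  "naturally_isomorphic C D F G \<longleftrightarrow>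
    (\<exists>\<tau>. (\<forall>X \<in> Obj C. iso_arrow D (on_obj F X) (on_obj G X) (\<tau> X)) \<and>
      (\<forall>X \<in> Obj C. \<forall>Y \<in> Obj C. \<forall>f \<in> Hom C X Y.
        Comp D (on_obj F X) (on_obj F Y) (on_obj G Y) (\<tau> Y) (on_arr F X Y f) =
        Comp D (on_obj F X) (on_obj G X) (on_obj G Y) (on_arr G X Y f) (\<tau> X)))"

definition equivalence_functor ::
  "('o, 'a, 'm) cat_scheme \<Rightarrow> ('p, 'b, 'n) cat_scheme \<Rightarrow> ('o, 'a, 'p, 'b) functor_map \<Rightarrow> bool"
  where
  "equivalence_functor C D F \<longleftrightarrow> category_functor C D F \<and>
    (\<exists>G. category_functor D C G \<and>
      naturally_isomorphic C C (compose_functors G F) identity_functor \<and>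
      naturally_isomorphic D D (compose_functors F G) identity_functor)"


section \<open>Quantaloids\<close>

record ('o, 'a) quantaloid_data = "('o, 'a) cat" +
  Leq :: "'o \<Rightarrow> 'o \<Rightarrow> 'a \<Rightarrow> 'a \<Rightarrow> bool"

definition hom_lattice :: "('o, 'a, 'm) quantaloid_data_scheme \<Rightarrow> 'o \<Rightarrow> 'o \<Rightarrow> 'a gorder" where
  "hom_lattice Q X Y = \<lparr>carrier = Hom Q X Y, eq = (=), le = Leq Q X Y\<rparr>"

locale quantaloid = category Q
  for Q :: "('o, 'a, 'm) quantaloid_data_scheme" +
  assumes hom_complete_lattice:
      "\<lbrakk>X \<in> Obj Q; Y \<in> Obj Q\<rbrakk> \<Longrightarrow> complete_lattice (hom_lattice Q X Y)"
    and comp_Sup_right: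
      "\<lbrakk>X \<in> Obj Q; Y \<in> Obj Q; Z \<in> Obj Q; S \<subseteq> Hom Q X Y; g \<in> Hom Q Y Z\<rbrakk>
        \<Longrightarrow> Comp Q X Y Z g (\<Squnion>\<^bsub>hom_lattice Q X Y\<^esub> S) =
          \<Squnion>\<^bsub>hom_lattice Q X Z\<^esub> ((\<lambda>f. Comp Q X Y Z g f) ` S)"
    and comp_Sup_left:
      "\<lbrakk>X \<in> Obj Q; Y \<in> Obj Q; Z \<in> Obj Q; f \<in> Hom Q X Y; S \<subseteq> Hom Q Y Z\<rbrakk>
        \<Longrightarrow> Comp Q X Y Z (\<Squnion>\<^bsub>hom_lattice Q Y Z\<^esub> S) f =
          \<Squnion>\<^bsub>hom_lattice Q X Z\<^esub> ((\<lambda>g. Comp Q X Y Z g f) ` S)"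

locale quantaloid_hom =
  source: quantaloid Q + target: quantaloid R + category_functor Q R F
  for Q :: "('o, 'a, 'm) quantaloid_data_scheme"
    and R :: "('p, 'b, 'n) quantaloid_data_scheme"
    and F :: "('o, 'a, 'p, 'b) functor_map" +
  assumes preserves_Sup:
    "\<lbrakk>X \<in> Obj Q; Y \<in> Obj Q; S \<subseteq> Hom Q X Y\<rbrakk>
      \<Longrightarrow> on_arr F X Y (\<Squnion>\<^bsub>hom_lattice Q X Y\<^esub> S) =
        \<Squnion>\<^bsub>hom_lattice R (on_obj F X) (on_obj F Y)\<^esub> (on_arr F X Y ` S)"

text \<open>
  Being quantaloids is part of being equivalent quantaloids, so for quotients the equivalence
  includes the claim that the operations on equivalence classes are well defined.
\<close>

definition equivalent_quantaloids ::
  "('o, 'a, 'm) quantaloid_data_scheme \<Rightarrow> ('p, 'b, 'n) quantaloid_data_scheme \<Rightarrow> bool" where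
  "equivalent_quantaloids Q R \<longleftrightarrow> (\<exists>F. quantaloid_hom Q R F \<and> equivalence_functor Q R F)"

text \<open>
  The quotient by a congruence \<open>E\<close>, given as a family of equivalence relations on the hom-sets.
  The class of \<open>f\<close> is below the class of \<open>g\<close> iff the join of \<open>f\<close> and \<open>g\<close> is congruent to \<open>g\<close>;
  the composite of two classes is the \<open>E\<close>-saturation of the set of composites of their members,
  which for a congruence is a single class.
\<close>

definition quotient_quantaloid ::
  "('o, 'a, 'm) quantaloid_data_scheme \<Rightarrow> ('o \<Rightarrow> 'o \<Rightarrow> ('a \<times> 'a) set) \<Rightarrow>
    ('o, 'a set) quantaloid_data" where
  "quotient_quantaloid Q E =
    \<lparr>Obj = Obj Q,
     Hom = (\<lambda>X Y. Hom Q X Y // E X Y),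
     Ident = (\<lambda>X. E X X `` {Ident Q X}),
     Comp = (\<lambda>X Y Z B A. E X Z `` {Comp Q X Y Z g f | g f. g \<in> B \<and> f \<in> A}),
     Leq = (\<lambda>X Y A B. \<exists>f \<in> A. \<exists>g \<in> B. f \<squnion>\<^bsub>hom_lattice Q X Y\<^esub> g \<in> B)\<rparr>"


section \<open>Sets and relations\<close>

text \<open>
  There is no type of all sets, so the sets forming the objects of a category are those in a
  universe \<open>U\<close>, as usual when size matters. Nothing but closure under subsets and power sets is
  imposed on \<open>U\<close>. Since \<open>Pow X\<close> has another type than \<open>X\<close>, power sets are taken up to bijection.
\<close>

definition set_universe :: "'u set set \<Rightarrow> bool" where
  "set_universe U \<longleftrightarrow> U \<noteq> {} \<and>
    (\<forall>X \<in> U. \<forall>Y. Y \<subseteq> X \<longrightarrow> Y \<in> U) \<and>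
    (\<forall>X \<in> U. \<exists>P \<in> U. P \<approx> Pow X)"

text \<open>
  In particular the sets of a model of set theory form a universe, in any type \<open>'v\<close> where
  \<open>elts x\<close> is the set of elements of \<open>x\<close>. Extensionality, separation and power sets suffice.
\<close>

lemma set_universe_model:
  fixes elts :: "'v \<Rightarrow> 'v set"
  assumes ext: "inj elts"
    and sep: "\<And>x A. A \<subseteq> elts x \<Longrightarrow> A \<in> range elts"
    and pow: "\<And>x. {y. elts y \<subseteq> elts x} \<in> range elts"
  shows "set_universe (range elts)"
proof -
  have pow_eqpoll: "{y. elts y \<subseteq> elts x} \<approx> Pow (elts x)" for x
  proof -
    have "A \<in> elts ` {y. elts y \<subseteq> elts x}" if "A \<subseteq> elts x" for A
      using sep[OF that] that by auto
    then have "elts ` {y. elts y \<subseteq> elts x} = Pow (elts x)"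
      by auto
    then have "bij_betw elts {y. elts y \<subseteq> elts x} (Pow (elts x))"
      using inj_on_subset[OF ext subset_UNIV] by (simp add: bij_betw_def)
    then show ?thesis
      unfolding eqpoll_def by (rule exI[of _ elts])
  qed
  show ?thesis
    unfolding set_universe_def
  proof (intro conjI ballI allI impI)
    fix X Y
    assume X: "X \<in> range elts" and Y: "Y \<subseteq> X"
    then show "Y \<in> range elts"
      using sep by auto
  next
    fix X
    assume "X \<in> range elts"
    then obtain x where X: "X = elts x"
      by auto
    show "\<exists>P \<in> range elts. P \<approx> Pow X"
      unfolding X by (rule bexI, rule pow_eqpoll, rule pow)
  qed simp
qed

lemma set_universe_finite: "set_universe {X :: nat set. finite X}"
  unfolding set_universe_def
proof (intro conjI ballI allI impI)
  fix X Y :: "nat set"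
  assume "X \<in> {X. finite X}" and "Y \<subseteq> X"
  then show "Y \<in> {X. finite X}"
    by (simp add: finite_subset)
next
  fix X :: "nat set"
  assume "X \<in> {X. finite X}"
  then have "{0..<card (Pow X)} \<approx> Pow X"
    unfolding eqpoll_def by (intro ex_bij_betw_nat_finite) simp
  then show "\<exists>P \<in> {X :: nat set. finite X}. P \<approx> Pow X"
    by (rule bexI) simp
qed auto

text \<open>The operator \<open>O\<close> composes relations in diagrammatic order.\<close>

definition Rel :: "'u set set \<Rightarrow> ('u set, ('u \<times> 'u) set) quantaloid_data" where
  "Rel U =
    \<lparr>Obj = U,
     Hom = (\<lambda>X Y. Pow (X \<times> Y)),
     Ident = (\<lambda>X. Id_on X),
     Comp = (\<lambda>X Y Z \<psi> \<phi>. \<phi> O \<psi>),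
     Leq = (\<lambda>X Y \<phi> \<psi>. \<phi> \<subseteq> \<psi>)\<rparr>"


section \<open>The Freyd completion\<close>

definition Arr ::
  "('o, 'a, 'm) quantaloid_data_scheme \<Rightarrow> ('o \<times> 'o \<times> 'a, 'a \<times> 'a) quantaloid_data" where
  "Arr Q =
    \<lparr>Obj = {(X, Y, \<phi>). X \<in> Obj Q \<and> Y \<in> Obj Q \<and> \<phi> \<in> Hom Q X Y},
     Hom = (\<lambda>(X, Y, \<phi>) (X', Y', \<psi>).
       {(\<zeta>, \<eta>). \<zeta> \<in> Hom Q X X' \<and> \<eta> \<in> Hom Q Y Y' \<and>
         Comp Q X X' Y' \<psi> \<zeta> = Comp Q X Y Y' \<eta> \<phi>}),
     Ident = (\<lambda>(X, Y, \<phi>). (Ident Q X, Ident Q Y)),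
     Comp = (\<lambda>(X, Y, \<phi>) (X', Y', \<phi>') (X'', Y'', \<phi>'') (\<zeta>', \<eta>') (\<zeta>, \<eta>).
       (Comp Q X X' X'' \<zeta>' \<zeta>, Comp Q Y Y' Y'' \<eta>' \<eta>)),
     Leq = (\<lambda>(X, Y, \<phi>) (X', Y', \<psi>) (\<zeta>, \<eta>) (\<zeta>', \<eta>').
       Leq Q X X' \<zeta> \<zeta>' \<and> Leq Q Y Y' \<eta> \<eta>')\<rparr>"

definition diagonal_congruence ::
  "('o, 'a, 'm) quantaloid_data_scheme \<Rightarrow> 'o \<times> 'o \<times> 'a \<Rightarrow> 'o \<times> 'o \<times> 'a \<Rightarrow>
    (('a \<times> 'a) \<times> ('a \<times> 'a)) set" where
  "diagonal_congruence Q = (\<lambda>(X, Y, \<phi>) (X', Y', \<psi>).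
    {((\<zeta>, \<eta>), (\<zeta>', \<eta>')).
      (\<zeta>, \<eta>) \<in> Hom (Arr Q) (X, Y, \<phi>) (X', Y', \<psi>) \<and>
      (\<zeta>', \<eta>') \<in> Hom (Arr Q) (X, Y, \<phi>) (X', Y', \<psi>) \<and>
      Comp Q X X' Y' \<psi> \<zeta> = Comp Q X X' Y' \<psi> \<zeta>'})"

definition Freyd_completion ::
  "('o, 'a, 'm) quantaloid_data_scheme \<Rightarrow>
    ('o \<times> 'o \<times> 'a, ('a \<times> 'a) set) quantaloid_data" where
  "Freyd_completion Q = quotient_quantaloid (Arr Q) (diagonal_congruence Q)"


section \<open>Interior spaces and continuous relations\<close>

text \<open>Interior operators are extensional functions, so that they are determined by their values
  on the subsets of \<open>X\<close>.\<close>

definition interior_space :: "'u set \<Rightarrow> ('u set \<Rightarrow> 'u set) \<Rightarrow> bool" where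
  "interior_space X a \<longleftrightarrow>
    a \<in> Pow X \<rightarrow>\<^sub>E Pow X \<and>
    mono_on (Pow X) a \<and>
    (\<forall>A \<in> Pow X. a A \<subseteq> A) \<and>
    (\<forall>A \<in> Pow X. a (a A) = a A)"

definition pullback :: "('u \<times> 'v) set \<Rightarrow> 'v set \<Rightarrow> 'u set" where
  "pullback \<zeta> B = {x. \<exists>y \<in> B. (x, y) \<in> \<zeta>}"

definition continuous_rel ::
  "'u set \<times> ('u set \<Rightarrow> 'u set) \<Rightarrow> 'v set \<times> ('v set \<Rightarrow> 'v set) \<Rightarrow> ('u \<times> 'v) set \<Rightarrow> bool" where
  "continuous_rel = (\<lambda>(X, a) (Y, b) \<zeta>.
    \<zeta> \<subseteq> X \<times> Y \<and> (\<forall>B \<in> Pow Y. pullback \<zeta> (b B) \<subseteq> a (pullback \<zeta> B)))"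

definition IntRel ::
  "'u set set \<Rightarrow> ('u set \<times> ('u set \<Rightarrow> 'u set), ('u \<times> 'u) set) quantaloid_data" where
  "IntRel U =
    \<lparr>Obj = {(X, a). X \<in> U \<and> interior_space X a},
     Hom = (\<lambda>S T. {\<zeta>. continuous_rel S T \<zeta>}),
     Ident = (\<lambda>(X, a). Id_on X),
     Comp = (\<lambda>R S T \<xi> \<zeta>. \<zeta> O \<xi>),
     Leq = (\<lambda>S T \<zeta> \<xi>. \<zeta> \<subseteq> \<xi>)\<rparr>"

definition open_congruence ::
  "'u set \<times> ('u set \<Rightarrow> 'u set) \<Rightarrow> 'v set \<times> ('v set \<Rightarrow> 'v set) \<Rightarrow>
    (('u \<times> 'v) set \<times> ('u \<times> 'v) set) set" where
  "open_congruence = (\<lambda>(X, a) (Y, b).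
    {(\<zeta>, \<zeta>'). continuous_rel (X, a) (Y, b) \<zeta> \<and> continuous_rel (X, a) (Y, b) \<zeta>' \<and>
      (\<forall>B \<in> Pow Y. pullback \<zeta> (b B) = pullback \<zeta>' (b B))})"

definition IntRel_o ::
  "'u set set \<Rightarrow> ('u set \<times> ('u set \<Rightarrow> 'u set), ('u \<times> 'u) set set) quantaloid_data" where
  "IntRel_o U = quotient_quantaloid (IntRel U) open_congruence"

end

theory Submission
  imports Defs
begin

text \<open>
  A relation \<open>\<phi> : X \<rightarrow> Y\<close> makes \<open>X\<close> an interior space whose open sets are the unions of the fibres
  \<open>\<phi>\<^sup>*{y}\<close>. A relation \<open>\<zeta>\<close> is continuous for the spaces of \<open>\<phi>\<close> and \<open>\<psi>\<close> iff \<open>\<psi> \<circ> \<zeta> = \<eta> \<circ> \<phi>\<close> for some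
  \<open>\<eta>\<close>, and \<open>\<zeta>\<close>, \<open>\<zeta>'\<close> agree on open sets iff \<open>\<psi> \<circ> \<zeta> = \<psi> \<circ> \<zeta>'\<close>. So \<open>(\<zeta>, \<eta>) \<mapsto> \<zeta>\<close> is full and
  both preserves and reflects the two congruences, and hence induces a fully faithful homomorphism
  of the quotients. It is surjective on objects: an interior operator \<open>a\<close> comes from the relation
  \<open>x \<in> a(A)\<close> between points and subsets of \<open>X\<close>, the subsets being coded by a set of the universe.
\<close>

section \<open>Joins of arrows\<close>

text \<open>A congruence compatible with all joins gives every class a largest member, namely its
  own join. The quotient order, an existential statement about members, thereby becomes the order of
  \<open>Q\<close> between largest members, and a join of classes becomes the class of the join of
  largest members. This explicit form is needed because the joins of \<open>hom_lattice\<close> are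
  described only by choice.

  The component \<open>\<eta>\<close> can be forgotten because the congruence on squares sees only
  the diagonal \<open>\<zeta> O \<psi>\<close>. It can be recovered because continuity at the fibre
  of \<open>\<psi>\<close> over \<open>y'\<close> says that the fibre of the diagonal over
  \<open>y'\<close> is a union of fibres of \<open>\<phi>\<close>; the points over which these lie
  are the ones to relate to \<open>y'\<close>.

  On objects the passage to spaces is not injective, as different relations can have the same unions
  of fibres. An inverse functor therefore selects one relation for each space, and full faithfulness
  supplies the isomorphism back to the relation one started from.\<close>

abbreviation hom_Sup ::
  "('o, 'a, 'm) quantaloid_data_scheme \<Rightarrow> 'o \<Rightarrow> 'o \<Rightarrow> 'a set \<Rightarrow> 'a" where
  "hom_Sup Q X Y S \<equiv> \<Squnion>\<^bsub>hom_lattice Q X Y\<^esub> S"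

lemma hom_lattice_simps [simp]:
  "carrier (hom_lattice Q X Y) = Hom Q X Y"
  "eq (hom_lattice Q X Y) = (=)"
  "le (hom_lattice Q X Y) = Leq Q X Y"
  by (simp_all add: hom_lattice_def)

lemma least_Upper_hom_lattice_iff:
  assumes "S \<subseteq> Hom Q X Y"
  shows "least (hom_lattice Q X Y) j (Upper (hom_lattice Q X Y) S) \<longleftrightarrow>
    j \<in> Hom Q X Y \<and> (\<forall>f\<in>S. Leq Q X Y f j) \<and>
    (\<forall>k\<in>Hom Q X Y. (\<forall>f\<in>S. Leq Q X Y f k) \<longrightarrow> Leq Q X Y j k)"
  using assms unfolding least_def Upper_def by (simp add: subset_eq) blast

text \<open>The join is a Hilbert choice among least upper bounds, so antisymmetry on the hom-set is
  what determines its value. Completeness is not assumed: the rule also serves where it is still to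
  be shown.\<close>

lemma hom_Sup_eqI:
  assumes antisym: "\<And>f g. \<lbrakk>f \<in> Hom Q X Y; g \<in> Hom Q X Y; Leq Q X Y f g; Leq Q X Y g f\<rbrakk> \<Longrightarrow> f = g"
    and S: "S \<subseteq> Hom Q X Y"
    and j: "j \<in> Hom Q X Y"
    and upper: "\<And>f. f \<in> S \<Longrightarrow> Leq Q X Y f j"
    and least: "\<And>k. \<lbrakk>k \<in> Hom Q X Y; \<And>f. f \<in> S \<Longrightarrow> Leq Q X Y f k\<rbrakk> \<Longrightarrow> Leq Q X Y j k"
  shows "hom_Sup Q X Y S = j"
  unfolding sup_def least_Upper_hom_lattice_iff[OF S]
proof (rule some_equality)
  show "j \<in> Hom Q X Y \<and> (\<forall>f\<in>S. Leq Q X Y f j) \<and>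
    (\<forall>k\<in>Hom Q X Y. (\<forall>f\<in>S. Leq Q X Y f k) \<longrightarrow> Leq Q X Y j k)"
    using j upper least by blast
  fix i
  assume "i \<in> Hom Q X Y \<and> (\<forall>f\<in>S. Leq Q X Y f i) \<and>
    (\<forall>k\<in>Hom Q X Y. (\<forall>f\<in>S. Leq Q X Y f k) \<longrightarrow> Leq Q X Y i k)"
  then show "i = j"
    using j upper least antisym by blast
qed

section \<open>Order and joins in the hom-sets of a quantaloid\<close>

context quantaloid
begin

context
  fixes X Y
  assumes X: "X \<in> Obj Q" and Y: "Y \<in> Obj Q"
begin

interpretation L: complete_lattice "hom_lattice Q X Y"
  by (rule hom_complete_lattice[OF X Y])

lemma leq_refl: "f \<in> Hom Q X Y \<Longrightarrow> Leq Q X Y f f"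
  using L.le_refl by simp

lemma leq_antisym:
  "\<lbrakk>f \<in> Hom Q X Y; g \<in> Hom Q X Y; Leq Q X Y f g; Leq Q X Y g f\<rbrakk> \<Longrightarrow> f = g"
  using L.le_antisym by simp

lemma leq_trans:
  "\<lbrakk>f \<in> Hom Q X Y; g \<in> Hom Q X Y; h \<in> Hom Q X Y; Leq Q X Y f g; Leq Q X Y g h\<rbrakk>
    \<Longrightarrow> Leq Q X Y f h"
  using L.le_trans by simp

lemma hom_Sup_in_hom: "S \<subseteq> Hom Q X Y \<Longrightarrow> hom_Sup Q X Y S \<in> Hom Q X Y"
  using L.sup_closed by simp

lemma hom_Sup_upper: "\<lbrakk>S \<subseteq> Hom Q X Y; f \<in> S\<rbrakk> \<Longrightarrow> Leq Q X Y f (hom_Sup Q X Y S)"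
  using L.sup_upper by simp

lemma hom_Sup_least:
  assumes "S \<subseteq> Hom Q X Y" and "k \<in> Hom Q X Y" and "\<And>f. f \<in> S \<Longrightarrow> Leq Q X Y f k"
  shows "Leq Q X Y (hom_Sup Q X Y S) k"
  using L.sup_least[of S k] assms by (auto simp: Upper_def)

lemma binary_join_eq_right:
  assumes "f \<in> Hom Q X Y" and "g \<in> Hom Q X Y" and "Leq Q X Y f g"
  shows "f \<squnion>\<^bsub>hom_lattice Q X Y\<^esub> g = g"
  unfolding join_def using assms leq_refl leq_antisym by (intro hom_Sup_eqI) auto

end

end

text \<open>A presentation of a quantaloid by an explicit join operation \<open>J\<close>.
  Quotients, \<open>Arr\<close>, \<open>Rel\<close> and \<open>IntRel\<close> are all verified
  through it, and \<open>hom_Sup_eq\<close> then identifies the chosen joins with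
  \<open>J\<close>.\<close>

locale quantaloid_joins = category Q
  for Q :: "('o, 'a, 'm) quantaloid_data_scheme" +
  fixes J :: "'o \<Rightarrow> 'o \<Rightarrow> 'a set \<Rightarrow> 'a"
  assumes refl: "\<And>X Y f. \<lbrakk>X \<in> Obj Q; Y \<in> Obj Q; f \<in> Hom Q X Y\<rbrakk> \<Longrightarrow> Leq Q X Y f f"
    and antisym: "\<And>X Y f g. \<lbrakk>X \<in> Obj Q; Y \<in> Obj Q; f \<in> Hom Q X Y; g \<in> Hom Q X Y;
        Leq Q X Y f g; Leq Q X Y g f\<rbrakk> \<Longrightarrow> f = g"
    and trans: "\<And>X Y f g h. \<lbrakk>X \<in> Obj Q; Y \<in> Obj Q; f \<in> Hom Q X Y; g \<in> Hom Q X Y; h \<in> Hom Q X Y;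
        Leq Q X Y f g; Leq Q X Y g h\<rbrakk> \<Longrightarrow> Leq Q X Y f h"
    and closed: "\<And>X Y S. \<lbrakk>X \<in> Obj Q; Y \<in> Obj Q; S \<subseteq> Hom Q X Y\<rbrakk> \<Longrightarrow> J X Y S \<in> Hom Q X Y"
    and upper: "\<And>X Y S f. \<lbrakk>X \<in> Obj Q; Y \<in> Obj Q; S \<subseteq> Hom Q X Y; f \<in> S\<rbrakk> \<Longrightarrow> Leq Q X Y f (J X Y S)"
    and least: "\<And>X Y S k. \<lbrakk>X \<in> Obj Q; Y \<in> Obj Q; S \<subseteq> Hom Q X Y; k \<in> Hom Q X Y;
        \<And>f. f \<in> S \<Longrightarrow> Leq Q X Y f k\<rbrakk> \<Longrightarrow> Leq Q X Y (J X Y S) k"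
    and comp_right: "\<And>X Y Z S g. \<lbrakk>X \<in> Obj Q; Y \<in> Obj Q; Z \<in> Obj Q; S \<subseteq> Hom Q X Y; g \<in> Hom Q Y Z\<rbrakk>
        \<Longrightarrow> Comp Q X Y Z g (J X Y S) = J X Z (Comp Q X Y Z g ` S)"
    and comp_left: "\<And>X Y Z S f. \<lbrakk>X \<in> Obj Q; Y \<in> Obj Q; Z \<in> Obj Q; f \<in> Hom Q X Y; S \<subseteq> Hom Q Y Z\<rbrakk>
        \<Longrightarrow> Comp Q X Y Z (J Y Z S) f = J X Z ((\<lambda>g. Comp Q X Y Z g f) ` S)"
begin

lemma hom_Sup_eq:
  "\<lbrakk>X \<in> Obj Q; Y \<in> Obj Q; S \<subseteq> Hom Q X Y\<rbrakk> \<Longrightarrow> hom_Sup Q X Y S = J X Y S"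
  using antisym closed upper least by (intro hom_Sup_eqI) auto

lemma quantaloid: "quantaloid Q"
proof (intro quantaloid.intro quantaloid_axioms.intro category_axioms)
  fix X Y
  assume XY: "X \<in> Obj Q" "Y \<in> Obj Q"
  let ?L = "hom_lattice Q X Y"
  have po: "partial_order ?L"
    by unfold_locales (simp_all add: refl[OF XY], blast intro: antisym[OF XY],
        blast intro: trans[OF XY])
  show "complete_lattice ?L"
  proof (rule partial_order.complete_latticeI[OF po])
    show "\<exists>s. least ?L s (Upper ?L A)" if "A \<subseteq> carrier ?L" for A
    proof -
      have A: "A \<subseteq> Hom Q X Y" using that by simp
      show ?thesis
        unfolding least_Upper_hom_lattice_iff[OF A]
        using closed[OF XY A] upper[OF XY A] least[OF XY A] by blast
    qed
    show "\<exists>i. greatest ?L i (Lower ?L A)" if "A \<subseteq> carrier ?L" for A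
    proof -
      \<comment> \<open>Only joins are given, so the meet of \<open>A\<close> is obtained as the
        join of its lower bounds.\<close>
      let ?B = "{k \<in> Hom Q X Y. \<forall>f\<in>A. Leq Q X Y k f}"
      have B: "?B \<subseteq> Hom Q X Y" by blast
      have "greatest ?L (J X Y ?B) (Lower ?L A)"
        using closed[OF XY B] upper[OF XY B] least[OF XY B] that
        unfolding greatest_def Lower_def by auto
      then show ?thesis by blast
    qed
  qed
next
  fix X Y Z S g
  assume X: "X \<in> Obj Q" and Y: "Y \<in> Obj Q" and Z: "Z \<in> Obj Q"
    and S: "S \<subseteq> Hom Q X Y" and g: "g \<in> Hom Q Y Z"
  have "Comp Q X Y Z g ` S \<subseteq> Hom Q X Z"
    using comp_in_hom X Y Z S g by blast
  then show "Comp Q X Y Z g (hom_Sup Q X Y S) = hom_Sup Q X Z (Comp Q X Y Z g ` S)"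
    using X Y Z S g by (simp add: hom_Sup_eq comp_right)
next
  fix X Y Z f S
  assume X: "X \<in> Obj Q" and Y: "Y \<in> Obj Q" and Z: "Z \<in> Obj Q"
    and f: "f \<in> Hom Q X Y" and S: "S \<subseteq> Hom Q Y Z"
  have "(\<lambda>g. Comp Q X Y Z g f) ` S \<subseteq> Hom Q X Z"
    using comp_in_hom X Y Z S f by blast
  then show "Comp Q X Y Z (hom_Sup Q Y Z S) f = hom_Sup Q X Z ((\<lambda>g. Comp Q X Y Z g f) ` S)"
    using X Y Z S f by (simp add: hom_Sup_eq comp_left)
qed

end


section \<open>Quotient quantaloids\<close>

lemma quotient_quantaloid_simps [simp]:
  "Obj (quotient_quantaloid Q E) = Obj Q"
  "Hom (quotient_quantaloid Q E) X Y = Hom Q X Y // E X Y"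
  "Ident (quotient_quantaloid Q E) X = E X X `` {Ident Q X}"
  "Comp (quotient_quantaloid Q E) X Y Z B A =
    E X Z `` {Comp Q X Y Z g f | g f. g \<in> B \<and> f \<in> A}"
  "Leq (quotient_quantaloid Q E) X Y A B \<longleftrightarrow>
    (\<exists>f \<in> A. \<exists>g \<in> B. f \<squnion>\<^bsub>hom_lattice Q X Y\<^esub> g \<in> B)"
  by (simp_all add: quotient_quantaloid_def)

text \<open>In \<open>Sup_cong\<close> a family of congruent pairs is a subset of the relation
  itself: the pairs serve as their own indices, so no index type is quantified over.\<close>

locale quantaloid_congruence = quantaloid Q
  for Q :: "('o, 'a, 'm) quantaloid_data_scheme" +
  fixes E :: "'o \<Rightarrow> 'o \<Rightarrow> ('a \<times> 'a) set"
  assumes equiv_hom: "\<lbrakk>X \<in> Obj Q; Y \<in> Obj Q\<rbrakk> \<Longrightarrow> equiv (Hom Q X Y) (E X Y)"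
    and comp_cong: "\<lbrakk>X \<in> Obj Q; Y \<in> Obj Q; Z \<in> Obj Q; (f, f') \<in> E X Y; (g, g') \<in> E Y Z\<rbrakk>
      \<Longrightarrow> (Comp Q X Y Z g f, Comp Q X Y Z g' f') \<in> E X Z"
    and Sup_cong: "\<lbrakk>X \<in> Obj Q; Y \<in> Obj Q; S \<subseteq> E X Y\<rbrakk>
      \<Longrightarrow> (hom_Sup Q X Y (fst ` S), hom_Sup Q X Y (snd ` S)) \<in> E X Y"
begin

abbreviation "class X Y f \<equiv> E X Y `` {f}"

text \<open>Each class is represented by its own join, a canonical representative by
  \<open>hom_Sup_in_class\<close>.\<close>

definition quotient_Sup :: "'o \<Rightarrow> 'o \<Rightarrow> 'a set set \<Rightarrow> 'a set" where
  "quotient_Sup X Y S = class X Y (hom_Sup Q X Y (hom_Sup Q X Y ` S))"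

context
  fixes X Y
  assumes X: "X \<in> Obj Q" and Y: "Y \<in> Obj Q"
begin

lemma cong_refl: "f \<in> Hom Q X Y \<Longrightarrow> (f, f) \<in> E X Y"
  using equiv_hom[OF X Y] by (meson equiv_def refl_onD)

lemma cong_sym: "(f, g) \<in> E X Y \<Longrightarrow> (g, f) \<in> E X Y"
  using equiv_hom[OF X Y] by (meson equiv_def symD)

lemma cong_in_hom:
  assumes "(f, g) \<in> E X Y"
  shows "f \<in> Hom Q X Y" and "g \<in> Hom Q X Y"
  using equiv_class_eq_iff[OF equiv_hom[OF X Y]] assms by auto

lemma class_eq: "(f, g) \<in> E X Y \<Longrightarrow> class X Y f = class X Y g"
  by (rule equiv_class_eq[OF equiv_hom[OF X Y]])

lemma class_in_quotient: "f \<in> Hom Q X Y \<Longrightarrow> class X Y f \<in> Hom Q X Y // E X Y"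
  by (rule quotientI)

lemma class_of_mem: "\<lbrakk>A \<in> Hom Q X Y // E X Y; f \<in> A\<rbrakk> \<Longrightarrow> class X Y f = A"
  using class_eq by (auto elim!: quotientE)

lemma quotient_subset: "A \<in> Hom Q X Y // E X Y \<Longrightarrow> A \<subseteq> Hom Q X Y"
  using cong_in_hom by (auto elim!: quotientE)

lemma quotient_mem_cong: "\<lbrakk>A \<in> Hom Q X Y // E X Y; f \<in> A; g \<in> A\<rbrakk> \<Longrightarrow> (f, g) \<in> E X Y"
  by (rule in_quotient_imp_in_rel[OF equiv_hom[OF X Y]]) auto

lemma quotient_nonempty: "A \<in> Hom Q X Y // E X Y \<Longrightarrow> \<exists>f. f \<in> A"
  using in_quotient_imp_non_empty[OF equiv_hom[OF X Y]] by blast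

text \<open>Every class has a largest element, and the quotient order is the order of the largest
  elements.\<close>

lemma hom_Sup_in_class:
  assumes A: "A \<in> Hom Q X Y // E X Y"
  shows "hom_Sup Q X Y A \<in> A"
proof -
  obtain f where f: "f \<in> A" using quotient_nonempty[OF A] by blast
  \<comment> \<open>The constant family \<open>f\<close> is paired with the family of all members of
    \<open>A\<close>. The first join is \<open>f\<close> itself, so the join of \<open>A\<close> is
    congruent to \<open>f\<close>.\<close>
  let ?S = "(\<lambda>g. (f, g)) ` A"
  have "?S \<subseteq> E X Y" using quotient_mem_cong[OF A f] by blast
  then have "(hom_Sup Q X Y (fst ` ?S), hom_Sup Q X Y (snd ` ?S)) \<in> E X Y"
    by (rule Sup_cong[OF X Y])
  moreover have "fst ` ?S = {f}" and "snd ` ?S = A" using f by force+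
  moreover have "hom_Sup Q X Y {f} = f"
    using f quotient_subset[OF A] leq_refl[OF X Y] leq_antisym[OF X Y]
    by (intro hom_Sup_eqI) auto
  ultimately show ?thesis using class_of_mem[OF A f] by auto
qed

lemma hom_Sup_class: "A \<in> Hom Q X Y // E X Y \<Longrightarrow> class X Y (hom_Sup Q X Y A) = A"
  by (rule class_of_mem[OF _ hom_Sup_in_class])

lemma binary_join_cong:
  assumes "(f, f') \<in> E X Y" and "(g, g') \<in> E X Y"
  shows "(f \<squnion>\<^bsub>hom_lattice Q X Y\<^esub> g, f' \<squnion>\<^bsub>hom_lattice Q X Y\<^esub> g') \<in> E X Y"
  using Sup_cong[OF X Y, of "{(f, f'), (g, g')}"] assms by (simp add: join_def)

text \<open>The largest member of \<open>B\<close> absorbs \<open>f\<close> and so is the witness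
  for the order. One arbitrary member of \<open>A\<close> is enough, which helps when the largest
  member of \<open>A\<close> is not explicit, as for \<open>quotient_Sup\<close>.\<close>

lemma quotient_leq_if_leq_Sup:
  assumes A: "A \<in> Hom Q X Y // E X Y" and B: "B \<in> Hom Q X Y // E X Y"
    and f: "f \<in> A" and le: "Leq Q X Y f (hom_Sup Q X Y B)"
  shows "Leq (quotient_quantaloid Q E) X Y A B"
proof -
  have m: "hom_Sup Q X Y B \<in> B" by (rule hom_Sup_in_class[OF B])
  have "f \<squnion>\<^bsub>hom_lattice Q X Y\<^esub> hom_Sup Q X Y B = hom_Sup Q X Y B"
    using quotient_subset[OF A] quotient_subset[OF B] f m le
    by (intro binary_join_eq_right[OF X Y]) auto
  then show ?thesis
    unfolding quotient_quantaloid_simps using f m by (intro bexI) simp_all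
qed

text \<open>The congruence moves the witnessing join of \<open>f\<close> and \<open>g\<close> to the
  join of the two largest members. That join then lies in \<open>B\<close>, hence below the largest
  member of \<open>B\<close>.\<close>

lemma quotient_leq_iff:
  assumes A: "A \<in> Hom Q X Y // E X Y" and B: "B \<in> Hom Q X Y // E X Y"
  shows "Leq (quotient_quantaloid Q E) X Y A B \<longleftrightarrow>
    Leq Q X Y (hom_Sup Q X Y A) (hom_Sup Q X Y B)"
proof
  assume "Leq (quotient_quantaloid Q E) X Y A B"
  then obtain f g where f: "f \<in> A" and g: "g \<in> B"
    and fg: "f \<squnion>\<^bsub>hom_lattice Q X Y\<^esub> g \<in> B" by auto
  let ?a = "hom_Sup Q X Y A" and ?b = "hom_Sup Q X Y B"
  let ?j = "?a \<squnion>\<^bsub>hom_lattice Q X Y\<^esub> ?b"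
  have a: "?a \<in> A" by (rule hom_Sup_in_class[OF A])
  have b: "?b \<in> B" by (rule hom_Sup_in_class[OF B])
  have ab: "?a \<in> Hom Q X Y" "?b \<in> Hom Q X Y"
    using a b quotient_subset[OF A] quotient_subset[OF B] by blast+
  have "(f \<squnion>\<^bsub>hom_lattice Q X Y\<^esub> g, ?j) \<in> E X Y"
    using quotient_mem_cong[OF A f a] quotient_mem_cong[OF B g b] by (rule binary_join_cong)
  then have "?j \<in> B" using class_of_mem[OF B fg] by auto
  then have "Leq Q X Y ?j ?b"
    by (rule hom_Sup_upper[OF X Y quotient_subset[OF B]])
  moreover have "Leq Q X Y ?a ?j" and "?j \<in> Hom Q X Y"
    using hom_Sup_upper[OF X Y, of "{?a, ?b}"] hom_Sup_in_hom[OF X Y, of "{?a, ?b}"] ab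
    by (auto simp: join_def)
  ultimately show "Leq Q X Y ?a ?b"
    using leq_trans[OF X Y ab(1) _ ab(2)] by blast
next
  assume "Leq Q X Y (hom_Sup Q X Y A) (hom_Sup Q X Y B)"
  then show "Leq (quotient_quantaloid Q E) X Y A B"
    by (rule quotient_leq_if_leq_Sup[OF A B hom_Sup_in_class[OF A]])
qed

section \<open>Joins of classes\<close>

lemma hom_Sup_image_in_hom:
  assumes "S \<subseteq> Hom Q X Y // E X Y"
  shows "hom_Sup Q X Y ` S \<subseteq> Hom Q X Y" and "hom_Sup Q X Y (hom_Sup Q X Y ` S) \<in> Hom Q X Y"
proof -
  show *: "hom_Sup Q X Y ` S \<subseteq> Hom Q X Y"
    using assms hom_Sup_in_hom[OF X Y quotient_subset] by blast
  show "hom_Sup Q X Y (hom_Sup Q X Y ` S) \<in> Hom Q X Y"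
    by (rule hom_Sup_in_hom[OF X Y *])
qed

lemma quotient_Sup_closed:
  "S \<subseteq> Hom Q X Y // E X Y \<Longrightarrow> quotient_Sup X Y S \<in> Hom Q X Y // E X Y"
  unfolding quotient_Sup_def by (intro class_in_quotient hom_Sup_image_in_hom)

lemma quotient_Sup_upper:
  assumes S: "S \<subseteq> Hom Q X Y // E X Y" and A: "A \<in> S"
  shows "Leq (quotient_quantaloid Q E) X Y A (quotient_Sup X Y S)"
proof -
  let ?s = "hom_Sup Q X Y (hom_Sup Q X Y ` S)"
  have A': "A \<in> Hom Q X Y // E X Y" using A S by blast
  have K: "quotient_Sup X Y S \<in> Hom Q X Y // E X Y" by (rule quotient_Sup_closed[OF S])
  have "?s \<in> quotient_Sup X Y S"
    unfolding quotient_Sup_def using cong_refl[OF hom_Sup_image_in_hom(2)[OF S]] by blast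
  \<comment> \<open>\<open>?s\<close> represents the join but need not be the largest member of its
    class, so one further comparison is required.\<close>
  then have "Leq Q X Y ?s (hom_Sup Q X Y (quotient_Sup X Y S))"
    by (rule hom_Sup_upper[OF X Y quotient_subset[OF K]])
  moreover have "Leq Q X Y (hom_Sup Q X Y A) ?s"
    using A by (intro hom_Sup_upper[OF X Y hom_Sup_image_in_hom(1)[OF S]]) auto
  ultimately have "Leq Q X Y (hom_Sup Q X Y A) (hom_Sup Q X Y (quotient_Sup X Y S))"
    using leq_trans[OF X Y _ hom_Sup_image_in_hom(2)[OF S]]
      hom_Sup_in_hom[OF X Y quotient_subset[OF A']] hom_Sup_in_hom[OF X Y quotient_subset[OF K]]
    by metis
  then show ?thesis
    unfolding quotient_leq_iff[OF A' K] .
qed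

lemma quotient_Sup_least:
  assumes S: "S \<subseteq> Hom Q X Y // E X Y" and B: "B \<in> Hom Q X Y // E X Y"
    and le: "\<And>A. A \<in> S \<Longrightarrow> Leq (quotient_quantaloid Q E) X Y A B"
  shows "Leq (quotient_quantaloid Q E) X Y (quotient_Sup X Y S) B"
proof (rule quotient_leq_if_leq_Sup[OF quotient_Sup_closed[OF S] B])
  show "hom_Sup Q X Y (hom_Sup Q X Y ` S) \<in> quotient_Sup X Y S"
    unfolding quotient_Sup_def using cong_refl[OF hom_Sup_image_in_hom(2)[OF S]] by blast
  show "Leq Q X Y (hom_Sup Q X Y (hom_Sup Q X Y ` S)) (hom_Sup Q X Y B)"
  proof (rule hom_Sup_least[OF X Y hom_Sup_image_in_hom(1)[OF S]])
    show "hom_Sup Q X Y B \<in> Hom Q X Y" by (rule hom_Sup_in_hom[OF X Y quotient_subset[OF B]])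
    fix f
    assume "f \<in> hom_Sup Q X Y ` S"
    then obtain A where A: "A \<in> S" and f: "f = hom_Sup Q X Y A" by blast
    from A S have "A \<in> Hom Q X Y // E X Y" by blast
    from le[OF A] show "Leq Q X Y f (hom_Sup Q X Y B)"
      unfolding f quotient_leq_iff[OF \<open>A \<in> Hom Q X Y // E X Y\<close> B] .
  qed
qed

lemma class_hom_Sup_image:
  assumes "\<And>i. i \<in> I \<Longrightarrow> (f i, g i) \<in> E X Y"
  shows "class X Y (hom_Sup Q X Y (f ` I)) = class X Y (hom_Sup Q X Y (g ` I))"
proof -
  let ?S = "(\<lambda>i. (f i, g i)) ` I"
  have "?S \<subseteq> E X Y" using assms by blast
  from class_eq[OF Sup_cong[OF X Y this]] show ?thesis
    by (simp add: image_image)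
qed

text \<open>Composition or a functor may send a largest member to one that is not largest, so joins
  of classes must be computable from arbitrary representatives. Each \<open>f i\<close> is congruent
  to the largest member of its class, and joins respect the congruence.\<close>

lemma class_hom_Sup_representatives:
  assumes "\<And>i. i \<in> I \<Longrightarrow> f i \<in> Hom Q X Y"
  shows "quotient_Sup X Y ((\<lambda>i. class X Y (f i)) ` I) = class X Y (hom_Sup Q X Y (f ` I))"
proof -
  have "(hom_Sup Q X Y (class X Y (f i)), f i) \<in> E X Y" if "i \<in> I" for i
    using hom_Sup_in_class[OF class_in_quotient[OF assms[OF that]]] cong_sym by blast
  then show ?thesis
    unfolding quotient_Sup_def image_image by (rule class_hom_Sup_image)
qed

end

text \<open>All composites of members are congruent, so the saturation that defines composition is
  the union of a single class with itself.\<close>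

lemma comp_class:
  assumes X: "X \<in> Obj Q" and Y: "Y \<in> Obj Q" and Z: "Z \<in> Obj Q"
    and f: "f \<in> Hom Q X Y" and g: "g \<in> Hom Q Y Z"
  shows "Comp (quotient_quantaloid Q E) X Y Z (class Y Z g) (class X Y f) =
    class X Z (Comp Q X Y Z g f)"
proof -
  let ?C = "{Comp Q X Y Z g' f' | g' f'. g' \<in> class Y Z g \<and> f' \<in> class X Y f}"
  have "class X Z h = class X Z (Comp Q X Y Z g f)" if h: "h \<in> ?C" for h
  proof -
    obtain g' f' where "h = Comp Q X Y Z g' f'" "(g, g') \<in> E Y Z" "(f, f') \<in> E X Y"
      using h by blast
    then show ?thesis
      using class_eq[OF X Z comp_cong[OF X Y Z]] by metis
  qed
  moreover have "Comp Q X Y Z g f \<in> ?C"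
    using cong_refl[OF X Y f] cong_refl[OF Y Z g] by blast
  ultimately have "(\<Union>h\<in>?C. class X Z h) = class X Z (Comp Q X Y Z g f)"
    by (metis (no_types, lifting) SUP_eq_const empty_iff)
  then show ?thesis
    unfolding quotient_quantaloid_simps Image_eq_UN[of _ ?C] .
qed

lemma category_quotient: "category (quotient_quantaloid Q E)"
proof
  fix X
  assume "X \<in> Obj (quotient_quantaloid Q E)"
  then show "Ident (quotient_quantaloid Q E) X \<in> Hom (quotient_quantaloid Q E) X X"
    using ident_in_hom class_in_quotient by simp
next
  fix X Y Z A B
  assume "X \<in> Obj (quotient_quantaloid Q E)" "Y \<in> Obj (quotient_quantaloid Q E)"
    "Z \<in> Obj (quotient_quantaloid Q E)"
    and A: "A \<in> Hom (quotient_quantaloid Q E) X Y" and B: "B \<in> Hom (quotient_quantaloid Q E) Y Z"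
  then have o: "X \<in> Obj Q" "Y \<in> Obj Q" "Z \<in> Obj Q" by simp_all
  obtain f where f: "f \<in> Hom Q X Y" "A = class X Y f" using A by (auto elim: quotientE)
  obtain g where g: "g \<in> Hom Q Y Z" "B = class Y Z g" using B by (auto elim: quotientE)
  show "Comp (quotient_quantaloid Q E) X Y Z B A \<in> Hom (quotient_quantaloid Q E) X Z"
    unfolding f(2) g(2) comp_class[OF o f(1) g(1)]
    using class_in_quotient comp_in_hom o f(1) g(1) by simp
next
  fix X Y A
  assume "X \<in> Obj (quotient_quantaloid Q E)" "Y \<in> Obj (quotient_quantaloid Q E)"
    and A: "A \<in> Hom (quotient_quantaloid Q E) X Y"
  then have o: "X \<in> Obj Q" "Y \<in> Obj Q" by simp_all
  obtain f where f: "f \<in> Hom Q X Y" "A = class X Y f" using A by (auto elim: quotientE)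
  note Ident = quotient_quantaloid_simps(3)
  show "Comp (quotient_quantaloid Q E) X X Y A (Ident (quotient_quantaloid Q E) X) = A"
    unfolding f(2) Ident comp_class[OF o(1) o(1) o(2) ident_in_hom[OF o(1)] f(1)]
    using comp_ident_right o f(1) by simp
  show "Comp (quotient_quantaloid Q E) X Y Y (Ident (quotient_quantaloid Q E) Y) A = A"
    unfolding f(2) Ident comp_class[OF o(1) o(2) o(2) f(1) ident_in_hom[OF o(2)]]
    using comp_ident_left o f(1) by simp
next
  fix W X Y Z A B C
  assume "W \<in> Obj (quotient_quantaloid Q E)" "X \<in> Obj (quotient_quantaloid Q E)"
    "Y \<in> Obj (quotient_quantaloid Q E)" "Z \<in> Obj (quotient_quantaloid Q E)"
    and A: "A \<in> Hom (quotient_quantaloid Q E) W X" and B: "B \<in> Hom (quotient_quantaloid Q E) X Y"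
    and C: "C \<in> Hom (quotient_quantaloid Q E) Y Z"
  then have o: "W \<in> Obj Q" "X \<in> Obj Q" "Y \<in> Obj Q" "Z \<in> Obj Q" by simp_all
  obtain f where f: "f \<in> Hom Q W X" "A = class W X f" using A by (auto elim: quotientE)
  obtain g where g: "g \<in> Hom Q X Y" "B = class X Y g" using B by (auto elim: quotientE)
  obtain h where h: "h \<in> Hom Q Y Z" "C = class Y Z h" using C by (auto elim: quotientE)
  show "Comp (quotient_quantaloid Q E) W Y Z C (Comp (quotient_quantaloid Q E) W X Y B A) =
    Comp (quotient_quantaloid Q E) W X Z (Comp (quotient_quantaloid Q E) X Y Z C B) A"
    using o f g h by (simp add: comp_class comp_in_hom comp_assoc del: quotient_quantaloid_simps)
qed

text \<open>The order axioms are those of \<open>Q\<close> at the largest members; antisymmetry also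
  uses that the largest member determines its class. Distributivity is that of \<open>Q\<close>,
  applied to the joins of the classes and carried over by \<open>comp_class\<close>.\<close>

lemma quantaloid_joins_quotient: "quantaloid_joins (quotient_quantaloid Q E) quotient_Sup"
proof -
  let ?R = "quotient_quantaloid Q E"
  have antisym: "A = B"
    if o: "X \<in> Obj Q" "Y \<in> Obj Q" and A: "A \<in> Hom Q X Y // E X Y" and B: "B \<in> Hom Q X Y // E X Y"
      and le: "Leq ?R X Y A B" "Leq ?R X Y B A" for X Y A B
  proof -
    have "hom_Sup Q X Y A = hom_Sup Q X Y B"
      using le[unfolded quotient_leq_iff[OF o A B] quotient_leq_iff[OF o B A]]
        quotient_subset[OF o] A B hom_Sup_in_hom[OF o] by (intro leq_antisym[OF o]) auto
    then show ?thesis using hom_Sup_class[OF o] A B by metis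
  qed
  have trans: "Leq ?R X Y A C"
    if o: "X \<in> Obj Q" "Y \<in> Obj Q" and h: "A \<in> Hom Q X Y // E X Y" "B \<in> Hom Q X Y // E X Y"
      "C \<in> Hom Q X Y // E X Y" and le: "Leq ?R X Y A B" "Leq ?R X Y B C" for X Y A B C
  proof -
    have "hom_Sup Q X Y K \<in> Hom Q X Y" if "K \<in> Hom Q X Y // E X Y" for K
      using hom_Sup_in_hom[OF o] quotient_subset[OF o that] .
    then show ?thesis
      using le leq_trans[OF o] h unfolding quotient_leq_iff[OF o h(1,2)]
        quotient_leq_iff[OF o h(2,3)] quotient_leq_iff[OF o h(1,3)] by blast
  qed
  have refl: "Leq ?R X Y A A"
    if o: "X \<in> Obj Q" "Y \<in> Obj Q" and A: "A \<in> Hom Q X Y // E X Y" for X Y A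
    unfolding quotient_leq_iff[OF o A A]
    by (rule leq_refl[OF o hom_Sup_in_hom[OF o quotient_subset[OF o A]]])
  have comp_right: "Comp ?R X Y Z B (quotient_Sup X Y S) = quotient_Sup X Z (Comp ?R X Y Z B ` S)"
    if o: "X \<in> Obj Q" "Y \<in> Obj Q" "Z \<in> Obj Q" and S: "S \<subseteq> Hom Q X Y // E X Y"
      and B: "B \<in> Hom Q Y Z // E Y Z" for X Y Z S B
  proof -
    obtain g where g: "g \<in> Hom Q Y Z" "B = class Y Z g" using B by (auto elim: quotientE)
    have m: "hom_Sup Q X Y A \<in> Hom Q X Y" if "A \<in> S" for A
      using hom_Sup_image_in_hom(1)[OF o(1,2) S] that by blast
    have "Comp ?R X Y Z B A = class X Z (Comp Q X Y Z g (hom_Sup Q X Y A))" if "A \<in> S" for A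
    proof -
      have "class X Y (hom_Sup Q X Y A) = A" using hom_Sup_class[OF o(1,2)] S that by blast
      with comp_class[OF o m[OF that] g(1)] show ?thesis unfolding g(2) by (simp only:)
    qed
    then have "Comp ?R X Y Z B ` S =
        (\<lambda>A. class X Z (Comp Q X Y Z g (hom_Sup Q X Y A))) ` S"
      by (intro image_cong) auto
    then have "quotient_Sup X Z (Comp ?R X Y Z B ` S) =
        class X Z (hom_Sup Q X Z ((\<lambda>A. Comp Q X Y Z g (hom_Sup Q X Y A)) ` S))"
      using class_hom_Sup_representatives[OF o(1,3), of S] comp_in_hom[OF o m g(1)]
      by (simp only:)
    also have "\<dots> = class X Z (Comp Q X Y Z g (hom_Sup Q X Y (hom_Sup Q X Y ` S)))"
      using comp_Sup_right[OF o hom_Sup_image_in_hom(1)[OF o(1,2) S] g(1)] by (simp add: image_image)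
    also have "\<dots> = Comp ?R X Y Z B (quotient_Sup X Y S)"
      unfolding quotient_Sup_def g(2)
      by (rule comp_class[OF o hom_Sup_image_in_hom(2)[OF o(1,2) S] g(1), symmetric])
    finally show ?thesis by simp
  qed
  have comp_left: "Comp ?R X Y Z (quotient_Sup Y Z S) A =
      quotient_Sup X Z ((\<lambda>B. Comp ?R X Y Z B A) ` S)"
    if o: "X \<in> Obj Q" "Y \<in> Obj Q" "Z \<in> Obj Q" and A: "A \<in> Hom Q X Y // E X Y"
      and S: "S \<subseteq> Hom Q Y Z // E Y Z" for X Y Z S A
  proof -
    obtain f where f: "f \<in> Hom Q X Y" "A = class X Y f" using A by (auto elim: quotientE)
    have m: "hom_Sup Q Y Z B \<in> Hom Q Y Z" if "B \<in> S" for B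
      using hom_Sup_image_in_hom(1)[OF o(2,3) S] that by blast
    have "Comp ?R X Y Z B A = class X Z (Comp Q X Y Z (hom_Sup Q Y Z B) f)" if "B \<in> S" for B
    proof -
      have "class Y Z (hom_Sup Q Y Z B) = B" using hom_Sup_class[OF o(2,3)] S that by blast
      with comp_class[OF o f(1) m[OF that]] show ?thesis unfolding f(2) by (simp only:)
    qed
    then have "(\<lambda>B. Comp ?R X Y Z B A) ` S =
        (\<lambda>B. class X Z (Comp Q X Y Z (hom_Sup Q Y Z B) f)) ` S"
      by (intro image_cong) auto
    then have "quotient_Sup X Z ((\<lambda>B. Comp ?R X Y Z B A) ` S) =
        class X Z (hom_Sup Q X Z ((\<lambda>B. Comp Q X Y Z (hom_Sup Q Y Z B) f) ` S))"
      using class_hom_Sup_representatives[OF o(1,3), of S] comp_in_hom[OF o f(1) m]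
      by (simp only:)
    also have "\<dots> = class X Z (Comp Q X Y Z (hom_Sup Q Y Z (hom_Sup Q Y Z ` S)) f)"
      using comp_Sup_left[OF o f(1) hom_Sup_image_in_hom(1)[OF o(2,3) S]] by (simp add: image_image)
    also have "\<dots> = Comp ?R X Y Z (quotient_Sup Y Z S) A"
      unfolding quotient_Sup_def f(2)
      by (rule comp_class[OF o f(1) hom_Sup_image_in_hom(2)[OF o(2,3) S], symmetric])
    finally show ?thesis by simp
  qed
  show ?thesis
  proof (intro quantaloid_joins.intro category_quotient quantaloid_joins_axioms.intro;
      unfold quotient_quantaloid_simps(1,2))
    show "Leq ?R X Y (quotient_Sup X Y S) B"
      if "X \<in> Obj Q" "Y \<in> Obj Q" "S \<subseteq> Hom Q X Y // E X Y" "B \<in> Hom Q X Y // E X Y"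
        "\<And>A. A \<in> S \<Longrightarrow> Leq ?R X Y A B" for X Y S B
      using that by (rule quotient_Sup_least)
  qed (rule refl trans antisym comp_right comp_left quotient_Sup_closed quotient_Sup_upper; assumption)+
qed

lemmas quantaloid_quotient = quantaloid_joins.quantaloid[OF quantaloid_joins_quotient]

lemma hom_Sup_quotient:
  "\<lbrakk>X \<in> Obj Q; Y \<in> Obj Q; S \<subseteq> Hom Q X Y // E X Y\<rbrakk>
    \<Longrightarrow> hom_Sup (quotient_quantaloid Q E) X Y S = quotient_Sup X Y S"
  using quantaloid_joins.hom_Sup_eq[OF quantaloid_joins_quotient, of X Y S] by simp

end


section \<open>Functors induced on quotients, and equivalences\<close>

text \<open>Direct images avoid a choice of representatives. That the image of a class is a whole
  class is not automatic; it is \<open>image_class\<close> below.\<close>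

definition image_functor :: "('o, 'a, 'p, 'b) functor_map \<Rightarrow> ('o, 'a set, 'p, 'b set) functor_map" where
  "image_functor F = \<lparr>on_obj = on_obj F, on_arr = (\<lambda>X Y A. on_arr F X Y ` A)\<rparr>"

lemma image_functor_simps [simp]:
  "on_obj (image_functor F) = on_obj F"
  "on_arr (image_functor F) X Y = (`) (on_arr F X Y)"
  by (simp_all add: image_functor_def)

definition fully_faithful ::
  "('o, 'a, 'm) cat_scheme \<Rightarrow> ('p, 'b, 'n) cat_scheme \<Rightarrow> ('o, 'a, 'p, 'b) functor_map \<Rightarrow> bool" where
  "fully_faithful C D F \<longleftrightarrow> (\<forall>X \<in> Obj C. \<forall>Y \<in> Obj C.
    bij_betw (on_arr F X Y) (Hom C X Y) (Hom D (on_obj F X) (on_obj F Y)))"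

locale full_congruence_hom =
  source: quantaloid_congruence Q E + target: quantaloid_congruence R E' + quantaloid_hom Q R F
  for Q :: "('o, 'a, 'm) quantaloid_data_scheme" and E
    and R :: "('p, 'b, 'n) quantaloid_data_scheme" and E' and F +
  assumes full: "\<lbrakk>X \<in> Obj Q; Y \<in> Obj Q; g \<in> Hom R (on_obj F X) (on_obj F Y)\<rbrakk>
      \<Longrightarrow> g \<in> on_arr F X Y ` Hom Q X Y"
    and cong_iff: "\<lbrakk>X \<in> Obj Q; Y \<in> Obj Q; f \<in> Hom Q X Y; f' \<in> Hom Q X Y\<rbrakk>
      \<Longrightarrow> (on_arr F X Y f, on_arr F X Y f') \<in> E' (on_obj F X) (on_obj F Y) \<longleftrightarrow> (f, f') \<in> E X Y"
begin

text \<open>Preservation of the congruence puts the image inside one class. Conversely, fullness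
  lifts any member of that class to an arrow of \<open>Q\<close>, and reflection puts the lift into
  the class of \<open>f\<close>.\<close>

lemma image_class:
  assumes X: "X \<in> Obj Q" and Y: "Y \<in> Obj Q" and f: "f \<in> Hom Q X Y"
  shows "on_arr F X Y ` source.class X Y f =
    target.class (on_obj F X) (on_obj F Y) (on_arr F X Y f)"
proof (intro equalityI subsetI)
  fix k
  assume "k \<in> on_arr F X Y ` source.class X Y f"
  then obtain h where "(f, h) \<in> E X Y" and "k = on_arr F X Y h" by blast
  then show "k \<in> target.class (on_obj F X) (on_obj F Y) (on_arr F X Y f)"
    using cong_iff[OF X Y f] source.cong_in_hom[OF X Y] by simp
next
  fix k
  assume k: "k \<in> target.class (on_obj F X) (on_obj F Y) (on_arr F X Y f)"
  then have "k \<in> Hom R (on_obj F X) (on_obj F Y)"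
    using target.cong_in_hom(2)[OF on_obj_closed[OF X] on_obj_closed[OF Y]] by simp
  from full[OF X Y this] obtain h where "h \<in> Hom Q X Y" and "k = on_arr F X Y h" by blast
  then show "k \<in> on_arr F X Y ` source.class X Y f"
    using k cong_iff[OF X Y f] by simp
qed

lemma quantaloid_hom_image:
  "quantaloid_hom (quotient_quantaloid Q E) (quotient_quantaloid R E') (image_functor F)"
proof (intro quantaloid_hom.intro quantaloid_hom_axioms.intro category_functor.intro
    category_functor_axioms.intro source.quantaloid_quotient target.quantaloid_quotient
    source.category_quotient target.category_quotient)
  fix X
  assume "X \<in> Obj (quotient_quantaloid Q E)"
  then have X: "X \<in> Obj Q" by simp
  show "on_obj (image_functor F) X \<in> Obj (quotient_quantaloid R E')"
    using on_obj_closed[OF X] by simp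
  show "on_arr (image_functor F) X X (Ident (quotient_quantaloid Q E) X) =
      Ident (quotient_quantaloid R E') (on_obj (image_functor F) X)"
    using image_class[OF X X source.ident_in_hom[OF X]] preserves_ident[OF X] by simp
next
  fix X Y A
  assume "X \<in> Obj (quotient_quantaloid Q E)" and "Y \<in> Obj (quotient_quantaloid Q E)"
    and A: "A \<in> Hom (quotient_quantaloid Q E) X Y"
  then have o: "X \<in> Obj Q" "Y \<in> Obj Q" by simp_all
  obtain f where f: "f \<in> Hom Q X Y" "A = source.class X Y f" using A by (auto elim: quotientE)
  show "on_arr (image_functor F) X Y A \<in>
      Hom (quotient_quantaloid R E') (on_obj (image_functor F) X) (on_obj (image_functor F) Y)"
    unfolding f(2) image_functor_simps image_class[OF o f(1)] quotient_quantaloid_simps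
    by (rule quotientI[OF on_arr_closed[OF o f(1)]])
next
  fix X Y Z A B
  assume "X \<in> Obj (quotient_quantaloid Q E)" and "Y \<in> Obj (quotient_quantaloid Q E)"
    and "Z \<in> Obj (quotient_quantaloid Q E)"
    and A: "A \<in> Hom (quotient_quantaloid Q E) X Y" and B: "B \<in> Hom (quotient_quantaloid Q E) Y Z"
  then have o: "X \<in> Obj Q" "Y \<in> Obj Q" "Z \<in> Obj Q" by simp_all
  obtain f where f: "f \<in> Hom Q X Y" "A = source.class X Y f" using A by (auto elim: quotientE)
  obtain g where g: "g \<in> Hom Q Y Z" "B = source.class Y Z g" using B by (auto elim: quotientE)
  note o' = on_obj_closed[OF o(1)] on_obj_closed[OF o(2)] on_obj_closed[OF o(3)]
  show "on_arr (image_functor F) X Z (Comp (quotient_quantaloid Q E) X Y Z B A) =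
      Comp (quotient_quantaloid R E') (on_obj (image_functor F) X) (on_obj (image_functor F) Y)
        (on_obj (image_functor F) Z)
        (on_arr (image_functor F) Y Z B) (on_arr (image_functor F) X Y A)"
    unfolding f(2) g(2) image_functor_simps source.comp_class[OF o f(1) g(1)]
      image_class[OF o(1,2) f(1)] image_class[OF o(2,3) g(1)]
      image_class[OF o(1,3) source.comp_in_hom[OF o f(1) g(1)]] preserves_comp[OF o f(1) g(1)]
    by (rule target.comp_class[OF o' on_arr_closed[OF o(1,2) f(1)] on_arr_closed[OF o(2,3) g(1)],
          symmetric])
next
  fix X Y S
  assume "X \<in> Obj (quotient_quantaloid Q E)" and "Y \<in> Obj (quotient_quantaloid Q E)"
    and "S \<subseteq> Hom (quotient_quantaloid Q E) X Y"
  then have o: "X \<in> Obj Q" "Y \<in> Obj Q" and S: "S \<subseteq> Hom Q X Y // E X Y" by simp_all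
  note o' = on_obj_closed[OF o(1)] on_obj_closed[OF o(2)]
  let ?F = "on_arr F X Y"
  have img: "?F ` A = target.class (on_obj F X) (on_obj F Y) (?F (hom_Sup Q X Y A))"
    if "A \<in> S" for A
  proof -
    have "A \<in> Hom Q X Y // E X Y" using S that by blast
    then have "source.class X Y (hom_Sup Q X Y A) = A" by (rule source.hom_Sup_class[OF o])
    moreover have "hom_Sup Q X Y A \<in> Hom Q X Y"
      using source.hom_Sup_image_in_hom(1)[OF o S] that by blast
    ultimately show ?thesis using image_class[OF o] by metis
  qed
  have closed: "?F (hom_Sup Q X Y A) \<in> Hom R (on_obj F X) (on_obj F Y)" if "A \<in> S" for A
    using source.hom_Sup_image_in_hom(1)[OF o S] that by (intro on_arr_closed[OF o]) auto
  have "(`) ?F ` S \<subseteq> Hom R (on_obj F X) (on_obj F Y) // E' (on_obj F X) (on_obj F Y)"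
    using img quotientI[OF closed] by auto
  note Sup' = target.hom_Sup_quotient[OF o' this]
  have "?F ` hom_Sup (quotient_quantaloid Q E) X Y S =
      target.class (on_obj F X) (on_obj F Y) (?F (hom_Sup Q X Y (hom_Sup Q X Y ` S)))"
    unfolding source.hom_Sup_quotient[OF o S] source.quotient_Sup_def
    by (rule image_class[OF o source.hom_Sup_image_in_hom(2)[OF o S]])
  also have "\<dots> = target.class (on_obj F X) (on_obj F Y)
      (hom_Sup R (on_obj F X) (on_obj F Y) ((\<lambda>A. ?F (hom_Sup Q X Y A)) ` S))"
    unfolding preserves_Sup[OF o source.hom_Sup_image_in_hom(1)[OF o S]] image_image ..
  \<comment> \<open>The images of the largest members are arbitrary representatives in the target,
    so its join is computed from those.\<close>
  also have "\<dots> = target.quotient_Sup (on_obj F X) (on_obj F Y)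
      ((\<lambda>A. target.class (on_obj F X) (on_obj F Y) (?F (hom_Sup Q X Y A))) ` S)"
    by (rule target.class_hom_Sup_representatives[OF o' closed, symmetric])
  also have "(\<lambda>A. target.class (on_obj F X) (on_obj F Y) (?F (hom_Sup Q X Y A))) ` S =
      (`) ?F ` S"
    by (intro image_cong refl img[symmetric])
  finally show "on_arr (image_functor F) X Y (hom_Sup (quotient_quantaloid Q E) X Y S) =
      hom_Sup (quotient_quantaloid R E') (on_obj (image_functor F) X) (on_obj (image_functor F) Y)
        (on_arr (image_functor F) X Y ` S)"
    unfolding image_functor_simps Sup' .
qed

lemma fully_faithful_image:
  "fully_faithful (quotient_quantaloid Q E) (quotient_quantaloid R E') (image_functor F)"
  unfolding fully_faithful_def quotient_quantaloid_simps image_functor_simps bij_betw_def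
proof (intro ballI conjI)
  fix X Y
  assume o: "X \<in> Obj Q" "Y \<in> Obj Q"
  note o' = on_obj_closed[OF o(1)] on_obj_closed[OF o(2)]
  show "inj_on ((`) (on_arr F X Y)) (Hom Q X Y // E X Y)"
  proof (rule inj_onI)
    fix A B
    assume A: "A \<in> Hom Q X Y // E X Y" and B: "B \<in> Hom Q X Y // E X Y"
      and eq: "on_arr F X Y ` A = on_arr F X Y ` B"
    obtain f where f: "f \<in> Hom Q X Y" "A = source.class X Y f" using A by (auto elim: quotientE)
    obtain g where g: "g \<in> Hom Q X Y" "B = source.class X Y g" using B by (auto elim: quotientE)
    have "(on_arr F X Y f, on_arr F X Y g) \<in> E' (on_obj F X) (on_obj F Y)"
      using eq target.cong_refl[OF o' on_arr_closed[OF o g(1)]]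
      unfolding f(2) g(2) image_class[OF o f(1)] image_class[OF o g(1)]
      by blast
    then show "A = B"
      unfolding f(2) g(2) cong_iff[OF o f(1) g(1)] by (rule source.class_eq[OF o])
  qed
  show "(`) (on_arr F X Y) ` (Hom Q X Y // E X Y) =
      Hom R (on_obj F X) (on_obj F Y) // E' (on_obj F X) (on_obj F Y)"
  proof (intro equalityI subsetI)
    fix B
    assume "B \<in> (`) (on_arr F X Y) ` (Hom Q X Y // E X Y)"
    then obtain f where "f \<in> Hom Q X Y" and "B = on_arr F X Y ` source.class X Y f"
      by (auto elim: quotientE)
    then show "B \<in> Hom R (on_obj F X) (on_obj F Y) // E' (on_obj F X) (on_obj F Y)"
      using image_class[OF o] on_arr_closed[OF o] by (simp add: quotientI)
  next
    fix B
    assume "B \<in> Hom R (on_obj F X) (on_obj F Y) // E' (on_obj F X) (on_obj F Y)"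
    then obtain g where "g \<in> Hom R (on_obj F X) (on_obj F Y)"
      and B: "B = target.class (on_obj F X) (on_obj F Y) g"
      by (rule quotientE)
    then obtain f where f: "f \<in> Hom Q X Y" and "g = on_arr F X Y f" using full[OF o] by blast
    then have "B = on_arr F X Y ` (source.class X Y f)"
      using image_class[OF o f] B by simp
    then show "B \<in> (`) (on_arr F X Y) ` (Hom Q X Y // E X Y)"
      using quotientI[OF f] by blast
  qed
qed

end

text \<open>Strict surjectivity on objects allows sections \<open>g\<close> and \<open>k\<close>
  with which \<open>F\<close> after \<open>G\<close> is the identity on objects and arrows, so
  identities are a natural isomorphism there. The other composite needs a genuine isomorphism, since
  \<open>F\<close> may identify objects.\<close>

lemma equivalence_functorI:
  assumes F: "category_functor C D F"
    and ff: "fully_faithful C D F"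
    and surj: "on_obj F ` Obj C = Obj D"
  shows "equivalence_functor C D F"
proof -
  interpret category_functor C D F by (rule F)
  define g where "g = inv_into (Obj C) (on_obj F)"
  define k where "k = (\<lambda>X Y. inv_into (Hom C X Y) (on_arr F X Y))"
  define G where "G = \<lparr>on_obj = g, on_arr = (\<lambda>X Y. k (g X) (g Y))\<rparr>"
  have g: "g Y \<in> Obj C" and Fg: "on_obj F (g Y) = Y" if "Y \<in> Obj D" for Y
    unfolding g_def using that surj by (auto intro: inv_into_into f_inv_into_f)
  have k: "k X Y h \<in> Hom C X Y" and Fk: "on_arr F X Y (k X Y h) = h"
    if "X \<in> Obj C" "Y \<in> Obj C" "h \<in> Hom D (on_obj F X) (on_obj F Y)" for X Y h
  proof -
    have "h \<in> on_arr F X Y ` Hom C X Y"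
      using ff that unfolding fully_faithful_def bij_betw_def by blast
    then show "k X Y h \<in> Hom C X Y" and "on_arr F X Y (k X Y h) = h"
      unfolding k_def by (rule inv_into_into, rule f_inv_into_f)
  qed
  \<comment> \<open>Every equation in \<open>C\<close> below is checked by applying
    \<open>F\<close>, where the lifts \<open>k\<close> disappear.\<close>
  have inj: "f = f'"
    if "on_arr F X Y f = on_arr F X Y f'" "X \<in> Obj C" "Y \<in> Obj C"
      "f \<in> Hom C X Y" "f' \<in> Hom C X Y" for X Y f f'
    using ff that unfolding fully_faithful_def bij_betw_def inj_on_def by blast
  have G: "category_functor D C G"
  proof (intro category_functor.intro category_functor_axioms.intro
      target.category_axioms source.category_axioms)
    fix X
    assume X: "X \<in> Obj D"
    show "on_obj G X \<in> Obj C" using g[OF X] by (simp add: G_def)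
    have "k (g X) (g X) (Ident D X) = Ident C (g X)"
      using target.ident_in_hom[OF X] source.ident_in_hom[OF g[OF X]]
      by (intro inj[of "g X" "g X"]) (simp_all add: Fk k X g Fg preserves_ident)
    then show "on_arr G X X (Ident D X) = Ident C (on_obj G X)" by (simp add: G_def)
  next
    fix X Y h
    assume "X \<in> Obj D" "Y \<in> Obj D" "h \<in> Hom D X Y"
    then show "on_arr G X Y h \<in> Hom C (on_obj G X) (on_obj G Y)"
      by (simp add: G_def k g Fg)
  next
    fix X Y Z h l
    assume o: "X \<in> Obj D" "Y \<in> Obj D" "Z \<in> Obj D" and h: "h \<in> Hom D X Y" and l: "l \<in> Hom D Y Z"
    have kh: "k (g X) (g Y) h \<in> Hom C (g X) (g Y)" and kl: "k (g Y) (g Z) l \<in> Hom C (g Y) (g Z)"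
      using o h l by (simp_all add: k g Fg)
    have lh: "Comp D X Y Z l h \<in> Hom D X Z" by (rule target.comp_in_hom[OF o h l])
    have "k (g X) (g Z) (Comp D X Y Z l h) =
        Comp C (g X) (g Y) (g Z) (k (g Y) (g Z) l) (k (g X) (g Y) h)"
      using o h l lh kh kl source.comp_in_hom[OF g g g kh kl] preserves_comp[OF g g g kh kl]
      by (intro inj[of "g X" "g Z"]) (simp_all add: Fk k g Fg)
    then show "on_arr G X Z (Comp D X Y Z l h) =
        Comp C (on_obj G X) (on_obj G Y) (on_obj G Z) (on_arr G Y Z l) (on_arr G X Y h)"
      by (simp add: G_def)
  qed
  \<comment> \<open>The objects \<open>g (on_obj F X)\<close> and \<open>X\<close> have the same
    image under \<open>F\<close>. The component at \<open>X\<close> is the lift of the identity of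
    that image, and lifting the identity in the other direction gives its inverse.\<close>
  have GF: "naturally_isomorphic C C (compose_functors G F) identity_functor"
    unfolding naturally_isomorphic_def compose_functors_def identity_functor_def G_def
      functor_map.simps
  proof (intro exI[of _ "\<lambda>X. k (g (on_obj F X)) X (Ident D (on_obj F X))"] conjI ballI)
    fix X
    assume X: "X \<in> Obj C"
    let ?X' = "g (on_obj F X)" and ?i = "Ident D (on_obj F X)"
    have FX: "on_obj F X \<in> Obj D" by (rule on_obj_closed[OF X])
    have X': "?X' \<in> Obj C" by (rule g[OF FX])
    have FX': "on_obj F ?X' = on_obj F X" by (rule Fg[OF FX])
    have i: "?i \<in> Hom D (on_obj F X) (on_obj F X)" by (rule target.ident_in_hom[OF FX])
    have ii: "Comp D (on_obj F X) (on_obj F X) (on_obj F X) ?i ?i = ?i"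
      by (rule target.comp_ident_left[OF FX FX i])
    have a: "k ?X' X ?i \<in> Hom C ?X' X" and b: "k X ?X' ?i \<in> Hom C X ?X'"
      using X X' i by (simp_all add: k FX')
    have "Comp C ?X' X ?X' (k X ?X' ?i) (k ?X' X ?i) = Ident C ?X'"
      using X X' i ii a b source.comp_in_hom[OF X' X X' a b] source.ident_in_hom[OF X']
      by (intro inj[of ?X' ?X']) (simp_all add: preserves_comp preserves_ident Fk FX')
    moreover have "Comp C X ?X' X (k ?X' X ?i) (k X ?X' ?i) = Ident C X"
      using X X' i ii a b source.comp_in_hom[OF X X' X b a] source.ident_in_hom[OF X]
      by (intro inj[of X X]) (simp_all add: preserves_comp preserves_ident Fk FX')
    ultimately show "iso_arrow C ?X' X (k ?X' X ?i)"
      unfolding iso_arrow_def using a b by blast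
  next
    fix X Y f
    assume X: "X \<in> Obj C" and Y: "Y \<in> Obj C" and f: "f \<in> Hom C X Y"
    let ?X' = "g (on_obj F X)" and ?Y' = "g (on_obj F Y)"
    let ?i = "Ident D (on_obj F X)" and ?j = "Ident D (on_obj F Y)" and ?f = "on_arr F X Y f"
    have FX: "on_obj F X \<in> Obj D" and FY: "on_obj F Y \<in> Obj D" by (rule on_obj_closed, fact)+
    have X': "?X' \<in> Obj C" and Y': "?Y' \<in> Obj C" by (rule g, fact)+
    have FX': "on_obj F ?X' = on_obj F X" and FY': "on_obj F ?Y' = on_obj F Y" by (rule Fg, fact)+
    have i: "?i \<in> Hom D (on_obj F X) (on_obj F X)" and j: "?j \<in> Hom D (on_obj F Y) (on_obj F Y)"
      by (rule target.ident_in_hom, fact)+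
    have Ff: "?f \<in> Hom D (on_obj F X) (on_obj F Y)" by (rule on_arr_closed[OF X Y f])
    have a: "k ?X' X ?i \<in> Hom C ?X' X" and b: "k ?Y' Y ?j \<in> Hom C ?Y' Y"
      and c: "k ?X' ?Y' ?f \<in> Hom C ?X' ?Y'"
      using X X' Y Y' i j Ff by (simp_all add: k FX' FY')
    \<comment> \<open>Under \<open>F\<close> the components become identities, so both sides are
      mapped to \<open>?f\<close>.\<close>
    show "Comp C ?X' ?Y' Y (k ?Y' Y ?j) (k ?X' ?Y' ?f) = Comp C ?X' X Y f (k ?X' X ?i)"
      using X X' Y Y' FX FY i j Ff a b c f source.comp_in_hom[OF X' Y' Y c b]
        source.comp_in_hom[OF X' X Y a f]
      by (intro inj[of ?X' Y])
        (simp_all add: preserves_comp Fk FX' FY' target.comp_ident_left target.comp_ident_right)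
  qed
  have FG: "naturally_isomorphic D D (compose_functors F G) identity_functor"
    unfolding naturally_isomorphic_def compose_functors_def identity_functor_def G_def
      functor_map.simps iso_arrow_def
    by (intro exI[of _ "Ident D"])
      (auto simp: Fg g k Fk target.ident_in_hom target.comp_ident_left target.comp_ident_right
        intro!: bexI[of _ "Ident D _"])
  show ?thesis
    unfolding equivalence_functor_def using F G GF FG by blast
qed


section \<open>The quantaloid of arrows and the Freyd completion\<close>

lemma Arr_simps [simp]:
  "(X, Y, \<phi>) \<in> Obj (Arr Q) \<longleftrightarrow> X \<in> Obj Q \<and> Y \<in> Obj Q \<and> \<phi> \<in> Hom Q X Y"
  "f \<in> Hom (Arr Q) (X, Y, \<phi>) (X', Y', \<psi>) \<longleftrightarrow>
    fst f \<in> Hom Q X X' \<and> snd f \<in> Hom Q Y Y' \<and>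
    Comp Q X X' Y' \<psi> (fst f) = Comp Q X Y Y' (snd f) \<phi>"
  "Ident (Arr Q) (X, Y, \<phi>) = (Ident Q X, Ident Q Y)"
  "Comp (Arr Q) (X, Y, \<phi>) (X', Y', \<phi>') (X'', Y'', \<phi>'') g f =
    (Comp Q X X' X'' (fst g) (fst f), Comp Q Y Y' Y'' (snd g) (snd f))"
  "Leq (Arr Q) (X, Y, \<phi>) (X', Y', \<psi>) f g \<longleftrightarrow>
    Leq Q X X' (fst f) (fst g) \<and> Leq Q Y Y' (snd f) (snd g)"
  by (auto simp: Arr_def split: prod.splits)

lemma diagonal_congruence_iff [simp]:
  "(f, g) \<in> diagonal_congruence Q (X, Y, \<phi>) (X', Y', \<psi>) \<longleftrightarrow>
    f \<in> Hom (Arr Q) (X, Y, \<phi>) (X', Y', \<psi>) \<and> g \<in> Hom (Arr Q) (X, Y, \<phi>) (X', Y', \<psi>) \<and>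
    Comp Q X X' Y' \<psi> (fst f) = Comp Q X X' Y' \<psi> (fst g)"
  by (cases f; cases g) (simp add: diagonal_congruence_def)

definition Arr_Sup ::
  "('o, 'a, 'm) quantaloid_data_scheme \<Rightarrow> 'o \<times> 'o \<times> 'a \<Rightarrow> 'o \<times> 'o \<times> 'a \<Rightarrow> ('a \<times> 'a) set \<Rightarrow> 'a \<times> 'a"
  where
  "Arr_Sup Q = (\<lambda>(X, Y, \<phi>) (X', Y', \<psi>) S. (hom_Sup Q X X' (fst ` S), hom_Sup Q Y Y' (snd ` S)))"

lemma Arr_Sup_apply [simp]:
  "Arr_Sup Q (X, Y, \<phi>) (X', Y', \<psi>) S = (hom_Sup Q X X' (fst ` S), hom_Sup Q Y Y' (snd ` S))"
  by (simp add: Arr_Sup_def)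

context quantaloid
begin

lemma category_Arr: "category (Arr Q)"
proof (intro category.intro; unfold split_paired_all)
  fix X Y \<phi> X' Y' \<phi>' X'' Y'' \<phi>'' \<zeta> \<eta> \<zeta>' \<eta>'
  assume "(X, Y, \<phi>) \<in> Obj (Arr Q)" "(X', Y', \<phi>') \<in> Obj (Arr Q)" "(X'', Y'', \<phi>'') \<in> Obj (Arr Q)"
    "(\<zeta>, \<eta>) \<in> Hom (Arr Q) (X, Y, \<phi>) (X', Y', \<phi>')"
    "(\<zeta>', \<eta>') \<in> Hom (Arr Q) (X', Y', \<phi>') (X'', Y'', \<phi>'')"
  then have o: "X \<in> Obj Q" "Y \<in> Obj Q" "X' \<in> Obj Q" "Y' \<in> Obj Q" "X'' \<in> Obj Q" "Y'' \<in> Obj Q"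
    and h: "\<phi> \<in> Hom Q X Y" "\<phi>' \<in> Hom Q X' Y'" "\<phi>'' \<in> Hom Q X'' Y''"
      "\<zeta> \<in> Hom Q X X'" "\<eta> \<in> Hom Q Y Y'" "\<zeta>' \<in> Hom Q X' X''" "\<eta>' \<in> Hom Q Y' Y''"
    and eq: "Comp Q X X' Y' \<phi>' \<zeta> = Comp Q X Y Y' \<eta> \<phi>"
      "Comp Q X' X'' Y'' \<phi>'' \<zeta>' = Comp Q X' Y' Y'' \<eta>' \<phi>'"
    by simp_all
  have "Comp Q X X'' Y'' \<phi>'' (Comp Q X X' X'' \<zeta>' \<zeta>) =
      Comp Q X X' Y'' (Comp Q X' X'' Y'' \<phi>'' \<zeta>') \<zeta>"
    by (rule comp_assoc) (fact o h)+
  also have "\<dots> = Comp Q X X' Y'' (Comp Q X' Y' Y'' \<eta>' \<phi>') \<zeta>" by (simp only: eq)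
  also have "\<dots> = Comp Q X Y' Y'' \<eta>' (Comp Q X X' Y' \<phi>' \<zeta>)"
    by (rule comp_assoc[symmetric]) (fact o h)+
  also have "\<dots> = Comp Q X Y' Y'' \<eta>' (Comp Q X Y Y' \<eta> \<phi>)" by (simp only: eq)
  also have "\<dots> = Comp Q X Y Y'' (Comp Q Y Y' Y'' \<eta>' \<eta>) \<phi>"
    by (rule comp_assoc) (fact o h)+
  finally show "Comp (Arr Q) (X, Y, \<phi>) (X', Y', \<phi>') (X'', Y'', \<phi>'') (\<zeta>', \<eta>') (\<zeta>, \<eta>) \<in>
      Hom (Arr Q) (X, Y, \<phi>) (X'', Y'', \<phi>'')"
    using comp_in_hom o h by simp
qed (auto simp: ident_in_hom comp_ident_left comp_ident_right comp_assoc)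

text \<open>Joins are componentwise. The join of commuting squares commutes because composition
  preserves joins on either side: both diagonals are joins of the same set of composites.\<close>

lemma quantaloid_joins_Arr: "quantaloid_joins (Arr Q) (Arr_Sup Q)"
proof (intro quantaloid_joins.intro category_Arr quantaloid_joins_axioms.intro;
    unfold split_paired_all)
  fix X Y \<phi> X' Y' \<psi> S
  assume "(X, Y, \<phi>) \<in> Obj (Arr Q)" "(X', Y', \<psi>) \<in> Obj (Arr Q)"
    and S: "S \<subseteq> Hom (Arr Q) (X, Y, \<phi>) (X', Y', \<psi>)"
  then have o: "X \<in> Obj Q" "Y \<in> Obj Q" "X' \<in> Obj Q" "Y' \<in> Obj Q"
    and h: "\<phi> \<in> Hom Q X Y" "\<psi> \<in> Hom Q X' Y'" by simp_all
  have S1: "fst ` S \<subseteq> Hom Q X X'" and S2: "snd ` S \<subseteq> Hom Q Y Y'" using S by auto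
  have "Comp Q X X' Y' \<psi> ` fst ` S = (\<lambda>\<eta>. Comp Q X Y Y' \<eta> \<phi>) ` snd ` S"
    unfolding image_image using S by (intro image_cong) auto
  then have "Comp Q X X' Y' \<psi> (hom_Sup Q X X' (fst ` S)) =
      Comp Q X Y Y' (hom_Sup Q Y Y' (snd ` S)) \<phi>"
    using comp_Sup_right[OF o(1,3,4) S1 h(2)] comp_Sup_left[OF o(1,2,4) h(1) S2] by simp
  then show "Arr_Sup Q (X, Y, \<phi>) (X', Y', \<psi>) S \<in> Hom (Arr Q) (X, Y, \<phi>) (X', Y', \<psi>)"
    using hom_Sup_in_hom[OF o(1,3) S1] hom_Sup_in_hom[OF o(2,4) S2] by simp
  show "Leq (Arr Q) (X, Y, \<phi>) (X', Y', \<psi>) (\<zeta>, \<eta>) (Arr_Sup Q (X, Y, \<phi>) (X', Y', \<psi>) S)"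
    if "(\<zeta>, \<eta>) \<in> S" for \<zeta> \<eta>
    using that hom_Sup_upper[OF o(1,3) S1] hom_Sup_upper[OF o(2,4) S2] by force
  show "Leq (Arr Q) (X, Y, \<phi>) (X', Y', \<psi>) (Arr_Sup Q (X, Y, \<phi>) (X', Y', \<psi>) S) (\<zeta>, \<eta>)"
    if "(\<zeta>, \<eta>) \<in> Hom (Arr Q) (X, Y, \<phi>) (X', Y', \<psi>)"
      "\<And>\<zeta>' \<eta>'. (\<zeta>', \<eta>') \<in> S \<Longrightarrow> Leq (Arr Q) (X, Y, \<phi>) (X', Y', \<psi>) (\<zeta>', \<eta>') (\<zeta>, \<eta>)" for \<zeta> \<eta>
    using that hom_Sup_least[OF o(1,3) S1, of \<zeta>] hom_Sup_least[OF o(2,4) S2, of \<eta>] by force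
next
  fix X Y \<phi> X' Y' \<phi>' X'' Y'' \<phi>'' S \<zeta> \<eta>
  assume "(X, Y, \<phi>) \<in> Obj (Arr Q)" "(X', Y', \<phi>') \<in> Obj (Arr Q)" "(X'', Y'', \<phi>'') \<in> Obj (Arr Q)"
    and S: "S \<subseteq> Hom (Arr Q) (X, Y, \<phi>) (X', Y', \<phi>')"
    and g: "(\<zeta>, \<eta>) \<in> Hom (Arr Q) (X', Y', \<phi>') (X'', Y'', \<phi>'')"
  then have o: "X \<in> Obj Q" "Y \<in> Obj Q" "X' \<in> Obj Q" "Y' \<in> Obj Q" "X'' \<in> Obj Q" "Y'' \<in> Obj Q"
    and h: "\<zeta> \<in> Hom Q X' X''" "\<eta> \<in> Hom Q Y' Y''" by simp_all
  have S1: "fst ` S \<subseteq> Hom Q X X'" and S2: "snd ` S \<subseteq> Hom Q Y Y'" using S by auto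
  show "Comp (Arr Q) (X, Y, \<phi>) (X', Y', \<phi>') (X'', Y'', \<phi>'') (\<zeta>, \<eta>)
        (Arr_Sup Q (X, Y, \<phi>) (X', Y', \<phi>') S) =
      Arr_Sup Q (X, Y, \<phi>) (X'', Y'', \<phi>'')
        (Comp (Arr Q) (X, Y, \<phi>) (X', Y', \<phi>') (X'', Y'', \<phi>'') (\<zeta>, \<eta>) ` S)"
    using comp_Sup_right[OF o(1,3,5) S1 h(1)] comp_Sup_right[OF o(2,4,6) S2 h(2)]
    by (simp add: image_image)
next
  fix X Y \<phi> X' Y' \<phi>' X'' Y'' \<phi>'' S \<zeta> \<eta>
  assume "(X, Y, \<phi>) \<in> Obj (Arr Q)" "(X', Y', \<phi>') \<in> Obj (Arr Q)" "(X'', Y'', \<phi>'') \<in> Obj (Arr Q)"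
    and f: "(\<zeta>, \<eta>) \<in> Hom (Arr Q) (X, Y, \<phi>) (X', Y', \<phi>')"
    and S: "S \<subseteq> Hom (Arr Q) (X', Y', \<phi>') (X'', Y'', \<phi>'')"
  then have o: "X \<in> Obj Q" "Y \<in> Obj Q" "X' \<in> Obj Q" "Y' \<in> Obj Q" "X'' \<in> Obj Q" "Y'' \<in> Obj Q"
    and h: "\<zeta> \<in> Hom Q X X'" "\<eta> \<in> Hom Q Y Y'" by simp_all
  have S1: "fst ` S \<subseteq> Hom Q X' X''" and S2: "snd ` S \<subseteq> Hom Q Y' Y''" using S by auto
  show "Comp (Arr Q) (X, Y, \<phi>) (X', Y', \<phi>') (X'', Y'', \<phi>'')
        (Arr_Sup Q (X', Y', \<phi>') (X'', Y'', \<phi>'') S) (\<zeta>, \<eta>) =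
      Arr_Sup Q (X, Y, \<phi>) (X'', Y'', \<phi>'')
        ((\<lambda>g. Comp (Arr Q) (X, Y, \<phi>) (X', Y', \<phi>') (X'', Y'', \<phi>'') g (\<zeta>, \<eta>)) ` S)"
    using comp_Sup_left[OF o(1,3,5) h(1) S1] comp_Sup_left[OF o(2,4,6) h(2) S2]
    by (simp add: image_image)
next
  fix X Y \<phi> X' Y' \<psi> \<zeta> \<eta> \<zeta>' \<eta>' \<zeta>'' \<eta>''
  assume "(X, Y, \<phi>) \<in> Obj (Arr Q)" "(X', Y', \<psi>) \<in> Obj (Arr Q)"
    and "(\<zeta>, \<eta>) \<in> Hom (Arr Q) (X, Y, \<phi>) (X', Y', \<psi>)"
    and "(\<zeta>', \<eta>') \<in> Hom (Arr Q) (X, Y, \<phi>) (X', Y', \<psi>)"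
    and "(\<zeta>'', \<eta>'') \<in> Hom (Arr Q) (X, Y, \<phi>) (X', Y', \<psi>)"
    and "Leq (Arr Q) (X, Y, \<phi>) (X', Y', \<psi>) (\<zeta>, \<eta>) (\<zeta>', \<eta>')"
    and "Leq (Arr Q) (X, Y, \<phi>) (X', Y', \<psi>) (\<zeta>', \<eta>') (\<zeta>'', \<eta>'')"
  then show "Leq (Arr Q) (X, Y, \<phi>) (X', Y', \<psi>) (\<zeta>, \<eta>) (\<zeta>'', \<eta>'')"
    using leq_trans[of X X' \<zeta> \<zeta>' \<zeta>''] leq_trans[of Y Y' \<eta> \<eta>' \<eta>''] by simp
next
  fix X Y \<phi> X' Y' \<psi> \<zeta> \<eta> \<zeta>' \<eta>'
  assume "(X, Y, \<phi>) \<in> Obj (Arr Q)" "(X', Y', \<psi>) \<in> Obj (Arr Q)"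
    and "(\<zeta>, \<eta>) \<in> Hom (Arr Q) (X, Y, \<phi>) (X', Y', \<psi>)"
    and "(\<zeta>', \<eta>') \<in> Hom (Arr Q) (X, Y, \<phi>) (X', Y', \<psi>)"
    and "Leq (Arr Q) (X, Y, \<phi>) (X', Y', \<psi>) (\<zeta>, \<eta>) (\<zeta>', \<eta>')"
    and "Leq (Arr Q) (X, Y, \<phi>) (X', Y', \<psi>) (\<zeta>', \<eta>') (\<zeta>, \<eta>)"
  then show "(\<zeta>, \<eta>) = (\<zeta>', \<eta>')"
    using leq_antisym[of X X' \<zeta> \<zeta>'] leq_antisym[of Y Y' \<eta> \<eta>'] by simp
qed (simp_all add: leq_refl)

lemmas quantaloid_Arr = quantaloid_joins.quantaloid[OF quantaloid_joins_Arr]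
  and hom_Sup_Arr = quantaloid_joins.hom_Sup_eq[OF quantaloid_joins_Arr]

lemma congruence_diagonal: "quantaloid_congruence (Arr Q) (diagonal_congruence Q)"
proof (intro quantaloid_congruence.intro quantaloid_Arr quantaloid_congruence_axioms.intro;
    unfold split_paired_all)
  fix X Y \<phi> X' Y' \<psi>
  show "equiv (Hom (Arr Q) (X, Y, \<phi>) (X', Y', \<psi>)) (diagonal_congruence Q (X, Y, \<phi>) (X', Y', \<psi>))"
    by (intro equivI refl_onI symI transI subrelI)
      (simp_all only: mem_Sigma_iff diagonal_congruence_iff simp_thms)
next
  fix X Y \<phi> X' Y' \<phi>' X'' Y'' \<phi>'' \<zeta>1 \<eta>1 \<zeta>1' \<eta>1' \<zeta>2 \<eta>2 \<zeta>2' \<eta>2'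
  assume P: "(X, Y, \<phi>) \<in> Obj (Arr Q)" "(X', Y', \<phi>') \<in> Obj (Arr Q)" "(X'', Y'', \<phi>'') \<in> Obj (Arr Q)"
    and 1: "((\<zeta>1, \<eta>1), (\<zeta>1', \<eta>1')) \<in> diagonal_congruence Q (X, Y, \<phi>) (X', Y', \<phi>')"
    and 2: "((\<zeta>2, \<eta>2), (\<zeta>2', \<eta>2')) \<in> diagonal_congruence Q (X', Y', \<phi>') (X'', Y'', \<phi>'')"
  then have o: "X \<in> Obj Q" "Y \<in> Obj Q" "X' \<in> Obj Q" "Y' \<in> Obj Q" "X'' \<in> Obj Q" "Y'' \<in> Obj Q"
    and h: "\<phi>' \<in> Hom Q X' Y'" "\<phi>'' \<in> Hom Q X'' Y''" "\<zeta>1 \<in> Hom Q X X'" "\<zeta>1' \<in> Hom Q X X'"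
      "\<zeta>2 \<in> Hom Q X' X''" "\<zeta>2' \<in> Hom Q X' X''" "\<eta>2' \<in> Hom Q Y' Y''"
    and comm: "Comp Q X' X'' Y'' \<phi>'' \<zeta>2' = Comp Q X' Y' Y'' \<eta>2' \<phi>'"
    by simp_all
  have eq: "Comp Q X X' Y' \<phi>' \<zeta>1 = Comp Q X X' Y' \<phi>' \<zeta>1'"
      "Comp Q X' X'' Y'' \<phi>'' \<zeta>2 = Comp Q X' X'' Y'' \<phi>'' \<zeta>2'"
    using 1 2 by (simp_all only: diagonal_congruence_iff fst_conv)
  have *: "Comp Q X X'' Y'' \<phi>'' (Comp Q X X' X'' \<zeta> \<xi>) =
      Comp Q X X' Y'' (Comp Q X' X'' Y'' \<phi>'' \<zeta>) \<xi>"
    if "\<zeta> \<in> Hom Q X' X''" "\<xi> \<in> Hom Q X X'" for \<zeta> \<xi>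
    by (rule comp_assoc) (fact o h that)+
  have **: "Comp Q X X' Y'' (Comp Q X' Y' Y'' \<eta>2' \<phi>') \<xi> = Comp Q X Y' Y'' \<eta>2' (Comp Q X X' Y' \<phi>' \<xi>)"
    if "\<xi> \<in> Hom Q X X'" for \<xi>
    by (rule comp_assoc[symmetric]) (fact o h that)+
  \<comment> \<open>First \<open>\<zeta>2\<close> is exchanged for \<open>\<zeta>2'\<close> under
    \<open>\<phi>''\<close>. The second square then turns \<open>\<phi>''\<close> after
    \<open>\<zeta>2'\<close> into \<open>\<eta>2'\<close> after \<open>\<phi>'\<close>, which brings
    \<open>\<phi>'\<close> next to \<open>\<zeta>1\<close> and lets it be exchanged for
    \<open>\<zeta>1'\<close>.\<close>
  have "Comp Q X X'' Y'' \<phi>'' (Comp Q X X' X'' \<zeta>2 \<zeta>1) =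
      Comp Q X X'' Y'' \<phi>'' (Comp Q X X' X'' \<zeta>2' \<zeta>1')"
    using h by (simp only: * ** eq comm)
  then show "(Comp (Arr Q) (X, Y, \<phi>) (X', Y', \<phi>') (X'', Y'', \<phi>'') (\<zeta>2, \<eta>2) (\<zeta>1, \<eta>1),
      Comp (Arr Q) (X, Y, \<phi>) (X', Y', \<phi>') (X'', Y'', \<phi>'') (\<zeta>2', \<eta>2') (\<zeta>1', \<eta>1'))
      \<in> diagonal_congruence Q (X, Y, \<phi>) (X'', Y'', \<phi>'')"
    using 1 2 category.comp_in_hom[OF category_Arr P]
    by (simp only: diagonal_congruence_iff) (simp del: Arr_simps(2))
next
  fix X Y \<phi> X' Y' \<psi> S
  assume P: "(X, Y, \<phi>) \<in> Obj (Arr Q)" "(X', Y', \<psi>) \<in> Obj (Arr Q)"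
    and S: "S \<subseteq> diagonal_congruence Q (X, Y, \<phi>) (X', Y', \<psi>)"
  then have o: "X \<in> Obj Q" "X' \<in> Obj Q" "Y' \<in> Obj Q" and \<psi>: "\<psi> \<in> Hom Q X' Y'" by simp_all
  have mem: "fst p \<in> Hom (Arr Q) (X, Y, \<phi>) (X', Y', \<psi>)"
      "snd p \<in> Hom (Arr Q) (X, Y, \<phi>) (X', Y', \<psi>)"
      "Comp Q X X' Y' \<psi> (fst (fst p)) = Comp Q X X' Y' \<psi> (fst (snd p))" if "p \<in> S" for p
  proof -
    have "(fst p, snd p) \<in> diagonal_congruence Q (X, Y, \<phi>) (X', Y', \<psi>)"
      unfolding prod.collapse by (rule subsetD[OF S that])
    then show "fst p \<in> Hom (Arr Q) (X, Y, \<phi>) (X', Y', \<psi>)"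
      "snd p \<in> Hom (Arr Q) (X, Y, \<phi>) (X', Y', \<psi>)"
      "Comp Q X X' Y' \<psi> (fst (fst p)) = Comp Q X X' Y' \<psi> (fst (snd p))"
      by (simp_all only: diagonal_congruence_iff)
  qed
  have S1: "fst ` S \<subseteq> Hom (Arr Q) (X, Y, \<phi>) (X', Y', \<psi>)"
    and S2: "snd ` S \<subseteq> Hom (Arr Q) (X, Y, \<phi>) (X', Y', \<psi>)"
    by (intro image_subsetI mem; assumption)+
  have T1: "fst ` fst ` S \<subseteq> Hom Q X X'" and T2: "fst ` snd ` S \<subseteq> Hom Q X X'"
    using mem(1,2) by (simp_all add: image_subset_iff)
  \<comment> \<open>The diagonal of a join is the join of the diagonals, and the two families have
    the same diagonals.\<close>
  have "Comp Q X X' Y' \<psi> ` fst ` fst ` S = Comp Q X X' Y' \<psi> ` fst ` snd ` S"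
    unfolding image_image by (intro image_cong refl mem)
  then have "Comp Q X X' Y' \<psi> (hom_Sup Q X X' (fst ` fst ` S)) =
      Comp Q X X' Y' \<psi> (hom_Sup Q X X' (fst ` snd ` S))"
    using comp_Sup_right[OF o T1 \<psi>] comp_Sup_right[OF o T2 \<psi>] by simp
  then show "(hom_Sup (Arr Q) (X, Y, \<phi>) (X', Y', \<psi>) (fst ` S),
      hom_Sup (Arr Q) (X, Y, \<phi>) (X', Y', \<psi>) (snd ` S))
      \<in> diagonal_congruence Q (X, Y, \<phi>) (X', Y', \<psi>)"
    using quantaloid_joins.closed[OF quantaloid_joins_Arr P S1]
      quantaloid_joins.closed[OF quantaloid_joins_Arr P S2]
    unfolding hom_Sup_Arr[OF P S1] hom_Sup_Arr[OF P S2] diagonal_congruence_iff by simp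
qed

end


section \<open>Relations and interior spaces\<close>

lemma Rel_simps [simp]:
  "Obj (Rel U) = U"
  "Hom (Rel U) X Y = Pow (X \<times> Y)"
  "Ident (Rel U) X = Id_on X"
  "Comp (Rel U) X Y Z \<psi> \<phi> = \<phi> O \<psi>"
  "Leq (Rel U) X Y \<phi> \<psi> \<longleftrightarrow> \<phi> \<subseteq> \<psi>"
  by (simp_all add: Rel_def)

lemma quantaloid_joins_Rel: "quantaloid_joins (Rel U) (\<lambda>X Y. \<Union>)"
  by (unfold_locales; simp; blast)

lemmas quantaloid_Rel = quantaloid_joins.quantaloid[OF quantaloid_joins_Rel]
  and hom_Sup_Rel = quantaloid_joins.hom_Sup_eq[OF quantaloid_joins_Rel]

lemma IntRel_simps [simp]:
  "(X, a) \<in> Obj (IntRel U) \<longleftrightarrow> X \<in> U \<and> interior_space X a"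
  "\<zeta> \<in> Hom (IntRel U) S T \<longleftrightarrow> continuous_rel S T \<zeta>"
  "Ident (IntRel U) (X, a) = Id_on X"
  "Comp (IntRel U) R S T \<xi> \<zeta> = \<zeta> O \<xi>"
  "Leq (IntRel U) S T \<zeta> \<xi> \<longleftrightarrow> \<zeta> \<subseteq> \<xi>"
  by (simp_all add: IntRel_def)

section \<open>Pullbacks of subsets and continuous relations\<close>

lemma pullback_comp: "pullback (\<zeta> O \<xi>) C = pullback \<zeta> (pullback \<xi> C)"
  by (auto simp: pullback_def)

lemma pullback_Union: "pullback (\<Union>S) B = (\<Union>\<zeta>\<in>S. pullback \<zeta> B)"
  by (auto simp: pullback_def)

lemma pullback_mono: "A \<subseteq> B \<Longrightarrow> pullback \<zeta> A \<subseteq> pullback \<zeta> B"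
  by (auto simp: pullback_def)

lemma pullback_subset: "\<zeta> \<subseteq> X \<times> Y \<Longrightarrow> pullback \<zeta> B \<subseteq> X"
  by (auto simp: pullback_def)

lemma pullback_Id_on: "B \<subseteq> X \<Longrightarrow> pullback (Id_on X) B = B"
  by (auto simp: pullback_def)

lemma interior_spaceD:
  assumes "interior_space X a"
  shows "A \<subseteq> X \<Longrightarrow> a A \<subseteq> A"
    and "A \<subseteq> X \<Longrightarrow> a (a A) = a A"
    and "\<lbrakk>A \<subseteq> B; B \<subseteq> X\<rbrakk> \<Longrightarrow> a A \<subseteq> a B"
    and "A \<subseteq> X \<Longrightarrow> a A \<subseteq> X"
  using assms unfolding interior_space_def mono_on_def by (auto simp: PiE_iff)

lemma continuous_rel_iff:
  "continuous_rel (X, a) (Y, b) \<zeta> \<longleftrightarrow>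
    \<zeta> \<subseteq> X \<times> Y \<and> (\<forall>B. B \<subseteq> Y \<longrightarrow> pullback \<zeta> (b B) \<subseteq> a (pullback \<zeta> B))"
  by (auto simp: continuous_rel_def)

lemma continuous_relD:
  assumes "continuous_rel (X, a) (Y, b) \<zeta>"
  shows "\<zeta> \<subseteq> X \<times> Y" and "B \<subseteq> Y \<Longrightarrow> pullback \<zeta> (b B) \<subseteq> a (pullback \<zeta> B)"
  using assms by (auto simp: continuous_rel_iff)

lemma continuous_rel_comp:
  assumes \<zeta>: "continuous_rel (X, a) (Y, b) \<zeta>" and \<xi>: "continuous_rel (Y, b) (Z, c) \<xi>"
  shows "continuous_rel (X, a) (Z, c) (\<zeta> O \<xi>)"
  unfolding continuous_rel_iff pullback_comp
proof (intro conjI allI impI)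
  show "\<zeta> O \<xi> \<subseteq> X \<times> Z"
    using continuous_relD(1)[OF \<zeta>] continuous_relD(1)[OF \<xi>] by blast
  fix C
  assume C: "C \<subseteq> Z"
  have "pullback \<zeta> (pullback \<xi> (c C)) \<subseteq> pullback \<zeta> (b (pullback \<xi> C))"
    by (rule pullback_mono[OF continuous_relD(2)[OF \<xi> C]])
  also have "\<dots> \<subseteq> a (pullback \<zeta> (pullback \<xi> C))"
    by (rule continuous_relD(2)[OF \<zeta> pullback_subset[OF continuous_relD(1)[OF \<xi>]]])
  finally show "pullback \<zeta> (pullback \<xi> (c C)) \<subseteq> a (pullback \<zeta> (pullback \<xi> C))" .
qed

text \<open>Pullback preserves unions in the relation, and monotonicity of \<open>a\<close> absorbs
  the passage from each member's pullback to that of the union.\<close>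

lemma continuous_rel_Union:
  assumes a: "interior_space X a" and S: "\<And>\<zeta>. \<zeta> \<in> S \<Longrightarrow> continuous_rel (X, a) (Y, b) \<zeta>"
  shows "continuous_rel (X, a) (Y, b) (\<Union>S)"
  unfolding continuous_rel_iff
proof (intro conjI allI impI)
  show sub: "\<Union>S \<subseteq> X \<times> Y" using continuous_relD(1)[OF S] by blast
  fix B
  assume B: "B \<subseteq> Y"
  have "pullback \<zeta> (b B) \<subseteq> a (pullback (\<Union>S) B)" if "\<zeta> \<in> S" for \<zeta>
  proof -
    have "pullback \<zeta> B \<subseteq> pullback (\<Union>S) B" using that unfolding pullback_Union by blast
    from interior_spaceD(3)[OF a this pullback_subset[OF sub]]
    show ?thesis using continuous_relD(2)[OF S[OF that] B] by blast
  qed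
  then show "pullback (\<Union>S) (b B) \<subseteq> a (pullback (\<Union>S) B)"
    unfolding pullback_Union[of _ "b B"] by blast
qed

lemma continuous_rel_Id_on:
  assumes "interior_space X a"
  shows "continuous_rel (X, a) (X, a) (Id_on X)"
  using interior_spaceD[OF assms] by (auto simp: continuous_rel_iff pullback_Id_on)

lemma category_IntRel: "category (IntRel U)"
proof (intro category.intro; unfold split_paired_all IntRel_simps)
  fix X a Y b \<zeta>
  assume "continuous_rel (X, a) (Y, b) \<zeta>"
  from continuous_relD(1)[OF this] show "Id_on X O \<zeta> = \<zeta>" and "\<zeta> O Id_on Y = \<zeta>" by blast+
qed (auto intro: continuous_rel_comp continuous_rel_Id_on)

lemma quantaloid_joins_IntRel: "quantaloid_joins (IntRel U) (\<lambda>S T. \<Union>)"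
proof (intro quantaloid_joins.intro category_IntRel quantaloid_joins_axioms.intro;
    unfold split_paired_all)
  fix X a Y b S
  assume "(X, a) \<in> Obj (IntRel U)" and "S \<subseteq> Hom (IntRel U) (X, a) (Y, b)"
  then show "\<Union>S \<in> Hom (IntRel U) (X, a) (Y, b)"
    by (auto simp: subset_eq intro: continuous_rel_Union)
qed auto

lemmas quantaloid_IntRel = quantaloid_joins.quantaloid[OF quantaloid_joins_IntRel]
  and hom_Sup_IntRel = quantaloid_joins.hom_Sup_eq[OF quantaloid_joins_IntRel]

section \<open>The congruence of agreement on open sets\<close>

lemma open_congruence_iff [simp]:
  "(\<zeta>, \<xi>) \<in> open_congruence (X, a) (Y, b) \<longleftrightarrow>
    continuous_rel (X, a) (Y, b) \<zeta> \<and> continuous_rel (X, a) (Y, b) \<xi> \<and>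
    (\<forall>B. B \<subseteq> Y \<longrightarrow> pullback \<zeta> (b B) = pullback \<xi> (b B))"
  by (auto simp: open_congruence_def)

text \<open>Continuity is applied to \<open>c C\<close>, which \<open>c\<close> fixes. This puts
  pullbacks of open sets among the values of \<open>b\<close>, the only sets on which congruent
  relations are known to agree, and so makes the congruence compatible with composition.\<close>

lemma continuous_rel_pullback_open:
  assumes b: "interior_space Y b" and c: "interior_space Z c"
    and \<xi>: "continuous_rel (Y, b) (Z, c) \<xi>" and C: "C \<subseteq> Z"
  shows "b (pullback \<xi> (c C)) = pullback \<xi> (c C)"
proof
  show "b (pullback \<xi> (c C)) \<subseteq> pullback \<xi> (c C)"
    by (rule interior_spaceD(1)[OF b pullback_subset[OF continuous_relD(1)[OF \<xi>]]])
  show "pullback \<xi> (c C) \<subseteq> b (pullback \<xi> (c C))"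
    using continuous_relD(2)[OF \<xi> interior_spaceD(4)[OF c C]] interior_spaceD(2)[OF c C] by simp
qed

lemma congruence_open: "quantaloid_congruence (IntRel U) open_congruence"
proof (intro quantaloid_congruence.intro quantaloid_IntRel quantaloid_congruence_axioms.intro;
    unfold split_paired_all)
  fix X a Y b
  show "equiv (Hom (IntRel U) (X, a) (Y, b)) (open_congruence (X, a) (Y, b))"
    by (intro equivI refl_onI symI transI subrelI) simp_all
next
  fix X a Y b Z c \<zeta> \<zeta>' \<xi> \<xi>'
  assume "(X, a) \<in> Obj (IntRel U)" "(Y, b) \<in> Obj (IntRel U)" "(Z, c) \<in> Obj (IntRel U)"
    and \<zeta>: "(\<zeta>, \<zeta>') \<in> open_congruence (X, a) (Y, b)"
    and \<xi>: "(\<xi>, \<xi>') \<in> open_congruence (Y, b) (Z, c)"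
  then have b: "interior_space Y b" and c: "interior_space Z c"
    by simp_all
  have "pullback (\<zeta> O \<xi>) (c C) = pullback (\<zeta>' O \<xi>') (c C)" if C: "C \<subseteq> Z" for C
  proof -
    let ?B = "pullback \<xi> (c C)"
    have cont: "continuous_rel (Y, b) (Z, c) \<xi>" using \<xi> by simp
    have "?B \<subseteq> Y" by (rule pullback_subset[OF continuous_relD(1)[OF cont]])
    then have "pullback \<zeta> (b ?B) = pullback \<zeta>' (b ?B)" using \<zeta> by simp
    then have "pullback \<zeta> ?B = pullback \<zeta>' ?B"
      unfolding continuous_rel_pullback_open[OF b c cont C] .
    moreover have "?B = pullback \<xi>' (c C)" using \<xi> C by simp
    ultimately show ?thesis by (simp add: pullback_comp)
  qed
  then show "(Comp (IntRel U) (X, a) (Y, b) (Z, c) \<xi> \<zeta>, Comp (IntRel U) (X, a) (Y, b) (Z, c) \<xi>' \<zeta>')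
      \<in> open_congruence (X, a) (Z, c)"
    using \<zeta> \<xi> continuous_rel_comp by auto
next
  fix X a Y b S
  assume P: "(X, a) \<in> Obj (IntRel U)" "(Y, b) \<in> Obj (IntRel U)"
    and S: "S \<subseteq> open_congruence (X, a) (Y, b)"
  have mem: "continuous_rel (X, a) (Y, b) \<zeta> \<and> continuous_rel (X, a) (Y, b) \<xi> \<and>
      (\<forall>B. B \<subseteq> Y \<longrightarrow> pullback \<zeta> (b B) = pullback \<xi> (b B))" if "(\<zeta>, \<xi>) \<in> S" for \<zeta> \<xi>
    using S that open_congruence_iff by blast
  have S1: "fst ` S \<subseteq> Hom (IntRel U) (X, a) (Y, b)" and S2: "snd ` S \<subseteq> Hom (IntRel U) (X, a) (Y, b)"
    using mem by force+
  have "pullback (\<Union>(fst ` S)) (b B) = pullback (\<Union>(snd ` S)) (b B)" if "B \<subseteq> Y" for B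
    unfolding pullback_Union image_image using mem that by (intro SUP_cong) auto
  then show "(hom_Sup (IntRel U) (X, a) (Y, b) (fst ` S), hom_Sup (IntRel U) (X, a) (Y, b) (snd ` S))
      \<in> open_congruence (X, a) (Y, b)"
    using quantaloid_joins.closed[OF quantaloid_joins_IntRel P S1]
      quantaloid_joins.closed[OF quantaloid_joins_IntRel P S2]
    unfolding hom_Sup_IntRel[OF P S1] hom_Sup_IntRel[OF P S2] open_congruence_iff by simp
qed


section \<open>From relations to interior spaces\<close>

text \<open>The open sets are the pullbacks along \<open>\<phi>\<close>; the points of \<open>Y\<close> index a base.\<close>

definition rel_interior :: "'u set \<Rightarrow> 'v set \<Rightarrow> ('u \<times> 'v) set \<Rightarrow> 'u set \<Rightarrow> 'u set" where
  "rel_interior X Y \<phi> =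
    restrict (\<lambda>A. pullback \<phi> {y \<in> Y. pullback \<phi> {y} \<subseteq> A}) (Pow X)"

lemma mem_rel_interior:
  "A \<subseteq> X \<Longrightarrow> x \<in> rel_interior X Y \<phi> A \<longleftrightarrow> (\<exists>y\<in>Y. (x, y) \<in> \<phi> \<and> pullback \<phi> {y} \<subseteq> A)"
  by (auto simp: rel_interior_def pullback_def)

lemma interior_space_rel_interior:
  assumes \<phi>: "\<phi> \<subseteq> X \<times> Y"
  shows "interior_space X (rel_interior X Y \<phi>)"
proof -
  have deflationary: "rel_interior X Y \<phi> A \<subseteq> A" if "A \<subseteq> X" for A
    using that by (auto simp: mem_rel_interior pullback_def)
  have mono: "rel_interior X Y \<phi> A \<subseteq> rel_interior X Y \<phi> B" if "A \<subseteq> B" "B \<subseteq> X" for A B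
    using that by (auto simp: mem_rel_interior) blast
  have "rel_interior X Y \<phi> A \<subseteq> rel_interior X Y \<phi> (rel_interior X Y \<phi> A)" if A: "A \<subseteq> X" for A
  proof
    fix x
    assume "x \<in> rel_interior X Y \<phi> A"
    then obtain y where y: "y \<in> Y" "(x, y) \<in> \<phi>" "pullback \<phi> {y} \<subseteq> A"
      using A by (auto simp: mem_rel_interior)
    \<comment> \<open>The fibre that witnesses \<open>x\<close> in the interior of \<open>A\<close>
      witnesses all its other points too, hence it lies in that interior.\<close>
    then have "pullback \<phi> {y} \<subseteq> rel_interior X Y \<phi> A"
      using A by (auto simp: mem_rel_interior pullback_def)
    moreover have "rel_interior X Y \<phi> A \<subseteq> X" using deflationary[OF A] A by blast
    ultimately show "x \<in> rel_interior X Y \<phi> (rel_interior X Y \<phi> A)"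
      using y by (auto simp: mem_rel_interior)
  qed
  moreover have "rel_interior X Y \<phi> \<in> Pow X \<rightarrow>\<^sub>E Pow X"
    using deflationary by (auto simp: rel_interior_def)
  ultimately show ?thesis
    unfolding interior_space_def mono_on_def using deflationary mono
    by (metis Pow_iff subset_antisym subset_trans)
qed

text \<open>The fibre over a code \<open>q\<close> is \<open>a (p q)\<close>, so the base consists
  of all open sets. By idempotence and monotonicity every open set inside \<open>A\<close> lies in
  \<open>a A\<close>, and the code of \<open>A\<close> has \<open>a A\<close> itself as its
  fibre.\<close>

lemma rel_interior_surj:
  assumes a: "interior_space X a" and p: "bij_betw p P (Pow X)"
  shows "rel_interior X P {(x, q). q \<in> P \<and> x \<in> a (p q)} = a"
proof
  let ?\<phi> = "{(x, q). q \<in> P \<and> x \<in> a (p q)}"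
  fix A
  show "rel_interior X P ?\<phi> A = a A"
  proof (cases "A \<subseteq> X")
    case True
    have pq: "p q \<subseteq> X" if "q \<in> P" for q using p that by (auto simp: bij_betw_def)
    have base: "pullback ?\<phi> {q} = a (p q)" if "q \<in> P" for q using that by (auto simp: pullback_def)
    show ?thesis
    proof (intro equalityI subsetI)
      fix x
      assume "x \<in> rel_interior X P ?\<phi> A"
      then obtain q where q: "q \<in> P" "x \<in> a (p q)" "a (p q) \<subseteq> A"
        using base by (auto simp: mem_rel_interior[OF True])
      then show "x \<in> a A"
        using interior_spaceD(2)[OF a pq] interior_spaceD(3)[OF a _ True] by blast
    next
      fix x
      assume x: "x \<in> a A"
      have "A \<in> p ` P" using p True by (simp add: bij_betw_def)
      then obtain q where "q \<in> P" "p q = A" by blast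
      then show "x \<in> rel_interior X P ?\<phi> A"
        using x base interior_spaceD(1)[OF a True] by (auto simp: mem_rel_interior[OF True])
    qed
  next
    \<comment> \<open>Both operators are extensional, so outside the power set each takes the
      default value \<open>undefined\<close>.\<close>
    case False
    then show ?thesis
      using a by (simp add: interior_space_def rel_interior_def PiE_iff extensional_def)
  qed
qed

text \<open>A basic open set, the fibre of \<open>\<psi>\<close> over \<open>y'\<close>, pulls back
  along \<open>\<zeta>\<close> to the fibre of \<open>\<phi> O \<eta>\<close> over
  \<open>y'\<close>. This is the union of the fibres of \<open>\<phi>\<close> over the points that
  \<open>\<eta>\<close> relates to \<open>y'\<close>, so it is open.\<close>

lemma continuous_rel_if_commutes:
  assumes \<zeta>: "\<zeta> \<subseteq> X \<times> X'" and \<eta>: "\<eta> \<subseteq> Y \<times> Y'" and eq: "\<zeta> O \<psi> = \<phi> O \<eta>"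
  shows "continuous_rel (X, rel_interior X Y \<phi>) (X', rel_interior X' Y' \<psi>) \<zeta>"
  unfolding continuous_rel_iff
proof (intro conjI allI impI subsetI \<zeta>[THEN subsetD])
  fix B x
  assume B: "B \<subseteq> X'" and "x \<in> pullback \<zeta> (rel_interior X' Y' \<psi> B)"
  then obtain x' y' where x': "(x, x') \<in> \<zeta>" and y': "(x', y') \<in> \<psi>" "pullback \<psi> {y'} \<subseteq> B"
    by (auto simp: pullback_def[of \<zeta>] mem_rel_interior)
  then obtain y where y: "(x, y) \<in> \<phi>" "(y, y') \<in> \<eta>" using eq by blast
  have "pullback \<phi> {y} \<subseteq> pullback \<zeta> B"
  proof
    fix z
    assume "z \<in> pullback \<phi> {y}"
    then have "(z, y') \<in> \<zeta> O \<psi>" using y(2) eq by (auto simp: pullback_def)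
    then show "z \<in> pullback \<zeta> B" using y'(2) by (auto simp: pullback_def)
  qed
  then show "x \<in> rel_interior X Y \<phi> (pullback \<zeta> B)"
    using y \<eta> by (auto simp: mem_rel_interior[OF pullback_subset[OF \<zeta>]])
qed

lemma commutes_if_continuous_rel:
  assumes \<phi>: "\<phi> \<subseteq> X \<times> Y" and \<psi>: "\<psi> \<subseteq> X' \<times> Y'"
    and \<zeta>: "continuous_rel (X, rel_interior X Y \<phi>) (X', rel_interior X' Y' \<psi>) \<zeta>"
  obtains \<eta> where "\<eta> \<subseteq> Y \<times> Y'" and "\<zeta> O \<psi> = \<phi> O \<eta>"
proof
  \<comment> \<open>The residual: the largest relation from \<open>Y\<close> to \<open>Y'\<close>
    with \<open>\<phi> O ?\<eta> \<subseteq> \<zeta> O \<psi>\<close>. The other inclusion is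
    continuity at the fibres of \<open>\<psi>\<close>.\<close>
  let ?\<eta> = "{(y, y') \<in> Y \<times> Y'. pullback \<phi> {y} \<subseteq> pullback (\<zeta> O \<psi>) {y'}}"
  show "?\<eta> \<subseteq> Y \<times> Y'" by blast
  show "\<zeta> O \<psi> = \<phi> O ?\<eta>"
  proof (intro equalityI subrelI)
    fix x y'
    assume "(x, y') \<in> \<zeta> O \<psi>"
    then obtain x' where x': "(x, x') \<in> \<zeta>" "(x', y') \<in> \<psi>" by blast
    let ?B = "pullback \<psi> {y'}"
    have B: "?B \<subseteq> X'" by (rule pullback_subset[OF \<psi>])
    have y': "y' \<in> Y'" using x'(2) \<psi> by blast
    have "x' \<in> rel_interior X' Y' \<psi> ?B" using x'(2) y' by (auto simp: mem_rel_interior[OF B])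
    then have "x \<in> pullback \<zeta> (rel_interior X' Y' \<psi> ?B)" using x'(1) by (auto simp: pullback_def)
    then have "x \<in> rel_interior X Y \<phi> (pullback \<zeta> ?B)" using continuous_relD(2)[OF \<zeta> B] by blast
    then obtain y where "y \<in> Y" "(x, y) \<in> \<phi>" "pullback \<phi> {y} \<subseteq> pullback (\<zeta> O \<psi>) {y'}"
      unfolding pullback_comp mem_rel_interior[OF pullback_subset[OF continuous_relD(1)[OF \<zeta>]]]
      by blast
    then show "(x, y') \<in> \<phi> O ?\<eta>" using y' by blast
  next
    fix x y'
    assume "(x, y') \<in> \<phi> O ?\<eta>"
    then show "(x, y') \<in> \<zeta> O \<psi>" by (auto simp: pullback_def)
  qed
qed

text \<open>Fibres of \<open>\<psi>\<close> are open, and a composite with \<open>\<psi>\<close> is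
  determined by its fibres, which are pullbacks of those. Conversely, every open set is a pullback
  along \<open>\<psi>\<close>, so pulling it back further involves only the composite.\<close>

lemma pullback_rel_interior_eq_iff:
  assumes \<psi>: "\<psi> \<subseteq> X' \<times> Y'"
  shows "(\<forall>B. B \<subseteq> X' \<longrightarrow> pullback \<zeta> (rel_interior X' Y' \<psi> B) = pullback \<xi> (rel_interior X' Y' \<psi> B))
    \<longleftrightarrow> \<zeta> O \<psi> = \<xi> O \<psi>"
proof
  assume eq: "\<forall>B. B \<subseteq> X' \<longrightarrow>
    pullback \<zeta> (rel_interior X' Y' \<psi> B) = pullback \<xi> (rel_interior X' Y' \<psi> B)"
  have "rel_interior X' Y' \<psi> (pullback \<psi> {y}) = pullback \<psi> {y}" for y
  proof
    show "rel_interior X' Y' \<psi> (pullback \<psi> {y}) \<subseteq> pullback \<psi> {y}"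
      by (rule interior_spaceD(1)[OF interior_space_rel_interior[OF \<psi>] pullback_subset[OF \<psi>]])
    show "pullback \<psi> {y} \<subseteq> rel_interior X' Y' \<psi> (pullback \<psi> {y})"
    proof
      fix x
      assume "x \<in> pullback \<psi> {y}"
      then have "(x, y) \<in> \<psi>" by (simp add: pullback_def)
      then show "x \<in> rel_interior X' Y' \<psi> (pullback \<psi> {y})"
        using \<psi> by (auto simp: mem_rel_interior[OF pullback_subset[OF \<psi>]])
    qed
  qed
  then have "pullback \<zeta> (pullback \<psi> {y}) = pullback \<xi> (pullback \<psi> {y})" for y
    using eq pullback_subset[OF \<psi>] by metis
  then have "pullback (\<zeta> O \<psi>) {y} = pullback (\<xi> O \<psi>) {y}" for y
    unfolding pullback_comp .
  then show "\<zeta> O \<psi> = \<xi> O \<psi>"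
    unfolding pullback_def by (auto simp: set_eq_iff)
next
  assume "\<zeta> O \<psi> = \<xi> O \<psi>"
  then show "\<forall>B. B \<subseteq> X' \<longrightarrow>
      pullback \<zeta> (rel_interior X' Y' \<psi> B) = pullback \<xi> (rel_interior X' Y' \<psi> B)"
    by (simp add: rel_interior_def flip: pullback_comp)
qed

section \<open>The comparison homomorphism and the equivalence\<close>

definition interior_functor ::
  "('u set \<times> 'u set \<times> ('u \<times> 'u) set, ('u \<times> 'u) set \<times> ('u \<times> 'u) set,
    'u set \<times> ('u set \<Rightarrow> 'u set), ('u \<times> 'u) set) functor_map" where
  "interior_functor =
    \<lparr>on_obj = (\<lambda>(X, Y, \<phi>). (X, rel_interior X Y \<phi>)), on_arr = (\<lambda>_ _. fst)\<rparr>"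

lemma interior_functor_simps [simp]:
  "on_obj interior_functor (X, Y, \<phi>) = (X, rel_interior X Y \<phi>)"
  "on_arr interior_functor P P' = fst"
  by (simp_all add: interior_functor_def)

lemma quantaloid_hom_interior_functor:
  "quantaloid_hom (Arr (Rel U)) (IntRel U) interior_functor"
proof (intro quantaloid_hom.intro quantaloid_hom_axioms.intro category_functor.intro
    category_functor_axioms.intro quantaloid.quantaloid_Arr[OF quantaloid_Rel] quantaloid_IntRel
    quantaloid.category_Arr[OF quantaloid_Rel] category_IntRel; unfold split_paired_all)
  fix X Y X' Y' :: "'a set" and \<phi> \<psi> S
  assume P: "(X, Y, \<phi>) \<in> Obj (Arr (Rel U))" "(X', Y', \<psi>) \<in> Obj (Arr (Rel U))"
    and S: "S \<subseteq> Hom (Arr (Rel U)) (X, Y, \<phi>) (X', Y', \<psi>)"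
  have P': "(X, rel_interior X Y \<phi>) \<in> Obj (IntRel U)" "(X', rel_interior X' Y' \<psi>) \<in> Obj (IntRel U)"
    using P by (simp_all add: interior_space_rel_interior)
  have mem: "fst f \<subseteq> X \<times> X' \<and> snd f \<subseteq> Y \<times> Y' \<and> fst f O \<psi> = \<phi> O snd f" if "f \<in> S" for f
    using subsetD[OF S that] by simp
  \<comment> \<open>The first components are read as arrows of \<open>Rel\<close> and as arrows of
    \<open>IntRel\<close>; in both, the join is the union.\<close>
  have S1: "fst ` S \<subseteq> Hom (Rel U) X X'"
    unfolding image_subset_iff using mem by simp
  have S2: "fst ` S \<subseteq> Hom (IntRel U) (X, rel_interior X Y \<phi>) (X', rel_interior X' Y' \<psi>)"
    unfolding image_subset_iff IntRel_simps using mem continuous_rel_if_commutes by metis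
  show "on_arr interior_functor (X, Y, \<phi>) (X', Y', \<psi>)
        (hom_Sup (Arr (Rel U)) (X, Y, \<phi>) (X', Y', \<psi>) S) =
      hom_Sup (IntRel U) (on_obj interior_functor (X, Y, \<phi>)) (on_obj interior_functor (X', Y', \<psi>))
        (on_arr interior_functor (X, Y, \<phi>) (X', Y', \<psi>) ` S)"
    using P S1 hom_Sup_Rel[OF _ _ S1]
    by (simp add: quantaloid.hom_Sup_Arr[OF quantaloid_Rel P S] hom_Sup_IntRel[OF P' S2])
next
  fix X Y X' Y' :: "'a set" and \<phi> \<psi> \<zeta> \<eta>
  assume "(\<zeta>, \<eta>) \<in> Hom (Arr (Rel U)) (X, Y, \<phi>) (X', Y', \<psi>)"
  then show "on_arr interior_functor (X, Y, \<phi>) (X', Y', \<psi>) (\<zeta>, \<eta>) \<in>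
      Hom (IntRel U) (on_obj interior_functor (X, Y, \<phi>)) (on_obj interior_functor (X', Y', \<psi>))"
    using continuous_rel_if_commutes[of \<zeta> X X' \<eta> Y Y' \<psi> \<phi>] by simp
qed (auto simp: interior_space_rel_interior)

lemma full_congruence_hom_interior_functor:
  "full_congruence_hom (Arr (Rel U)) (diagonal_congruence (Rel U)) (IntRel U) open_congruence
    interior_functor"
proof (intro full_congruence_hom.intro full_congruence_hom_axioms.intro
    quantaloid.congruence_diagonal[OF quantaloid_Rel] congruence_open
    quantaloid_hom_interior_functor; unfold split_paired_all)
  fix X Y X' Y' :: "'a set" and \<phi> \<psi> \<zeta>
  assume P: "(X, Y, \<phi>) \<in> Obj (Arr (Rel U))" "(X', Y', \<psi>) \<in> Obj (Arr (Rel U))"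
    and "\<zeta> \<in> Hom (IntRel U) (on_obj interior_functor (X, Y, \<phi>)) (on_obj interior_functor (X', Y', \<psi>))"
  then have \<zeta>: "continuous_rel (X, rel_interior X Y \<phi>) (X', rel_interior X' Y' \<psi>) \<zeta>" by simp
  have "\<phi> \<subseteq> X \<times> Y" "\<psi> \<subseteq> X' \<times> Y'" using P by simp_all
  from commutes_if_continuous_rel[OF this \<zeta>]
  obtain \<eta> where "\<eta> \<subseteq> Y \<times> Y'" "\<zeta> O \<psi> = \<phi> O \<eta>" .
  then have "(\<zeta>, \<eta>) \<in> Hom (Arr (Rel U)) (X, Y, \<phi>) (X', Y', \<psi>)"
    using continuous_relD(1)[OF \<zeta>] by simp
  then show "\<zeta> \<in> on_arr interior_functor (X, Y, \<phi>) (X', Y', \<psi>) `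
      Hom (Arr (Rel U)) (X, Y, \<phi>) (X', Y', \<psi>)"
    by (intro image_eqI[of _ _ "(\<zeta>, \<eta>)"]) simp_all
next
  fix X Y X' Y' :: "'a set" and \<phi> \<psi> \<zeta> \<eta> \<zeta>' \<eta>'
  assume "(X, Y, \<phi>) \<in> Obj (Arr (Rel U))" "(X', Y', \<psi>) \<in> Obj (Arr (Rel U))"
    "(\<zeta>, \<eta>) \<in> Hom (Arr (Rel U)) (X, Y, \<phi>) (X', Y', \<psi>)"
    "(\<zeta>', \<eta>') \<in> Hom (Arr (Rel U)) (X, Y, \<phi>) (X', Y', \<psi>)"
  then have "\<psi> \<subseteq> X' \<times> Y'"
    and "continuous_rel (X, rel_interior X Y \<phi>) (X', rel_interior X' Y' \<psi>) \<zeta>"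
    and "continuous_rel (X, rel_interior X Y \<phi>) (X', rel_interior X' Y' \<psi>) \<zeta>'"
    and "(\<zeta>, \<eta>) \<in> Hom (Arr (Rel U)) (X, Y, \<phi>) (X', Y', \<psi>)"
    and "(\<zeta>', \<eta>') \<in> Hom (Arr (Rel U)) (X, Y, \<phi>) (X', Y', \<psi>)"
    using continuous_rel_if_commutes[of _ X X' _ Y Y' \<psi> \<phi>] by (simp_all, blast+)
  then show "(on_arr interior_functor (X, Y, \<phi>) (X', Y', \<psi>) (\<zeta>, \<eta>),
        on_arr interior_functor (X, Y, \<phi>) (X', Y', \<psi>) (\<zeta>', \<eta>'))
      \<in> open_congruence (on_obj interior_functor (X, Y, \<phi>)) (on_obj interior_functor (X', Y', \<psi>))
    \<longleftrightarrow> ((\<zeta>, \<eta>), (\<zeta>', \<eta>')) \<in> diagonal_congruence (Rel U) (X, Y, \<phi>) (X', Y', \<psi>)"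
    by (simp add: pullback_rel_interior_eq_iff del: Arr_simps)
qed

text \<open>Closure of the universe under power sets, up to bijection, enters here: it supplies the
  set \<open>P\<close> of codes that serves as codomain of the relation.\<close>

lemma on_obj_interior_functor_surj:
  assumes "set_universe U"
  shows "on_obj interior_functor ` Obj (Arr (Rel U)) = Obj (IntRel U)"
proof (intro equalityI subsetI)
  fix T
  assume "T \<in> on_obj interior_functor ` Obj (Arr (Rel U))"
  then show "T \<in> Obj (IntRel U)" by (auto simp: interior_space_rel_interior)
next
  fix T
  assume "T \<in> Obj (IntRel U)"
  then obtain X a where T: "T = (X, a)" "X \<in> U" and a: "interior_space X a" by (cases T) auto
  then obtain P p where P: "P \<in> U" and p: "bij_betw p P (Pow X)"
    using assms unfolding set_universe_def eqpoll_def by meson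
  let ?\<phi> = "{(x, q). q \<in> P \<and> x \<in> a (p q)}"
  have "?\<phi> \<subseteq> X \<times> P" using interior_spaceD(4)[OF a] p by (auto simp: bij_betw_def)
  then have "(X, P, ?\<phi>) \<in> Obj (Arr (Rel U))" using T(2) P by simp
  moreover have "T = on_obj interior_functor (X, P, ?\<phi>)"
    using rel_interior_surj[OF a p] T(1) by simp
  ultimately show "T \<in> on_obj interior_functor ` Obj (Arr (Rel U))" by blast
qed

theorem corollary7p4:
  fixes U :: "'u set set"
  assumes "set_universe U"
  shows "equivalent_quantaloids (Freyd_completion (Rel U)) (IntRel_o U)"
proof -
  interpret full_congruence_hom "Arr (Rel U)" "diagonal_congruence (Rel U)" "IntRel U"
    open_congruence interior_functor
    by (rule full_congruence_hom_interior_functor)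
  have "equivalence_functor (Freyd_completion (Rel U)) (IntRel_o U) (image_functor interior_functor)"
    unfolding Freyd_completion_def IntRel_o_def
    by (rule equivalence_functorI[OF quantaloid_hom.axioms(3)[OF quantaloid_hom_image]
          fully_faithful_image]) (simp add: on_obj_interior_functor_surj[OF assms])
  then show ?thesis
    unfolding equivalent_quantaloids_def Freyd_completion_def IntRel_o_def
    using quantaloid_hom_image by blast
qed

end
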